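(* Let $F\in\mathcal M\Phi_+(H_{\mathcal A})$, $D\in B^a(H_{\mathcal A})$, and suppose that either $D\in\mathcal M\Phi_+(H_{\mathcal A})$ or there exist decompositions $$H_{\mathcal A} = M_1 \tilde\oplus N_1 \stackrel{F}{\longrightarrow} N_2^\perp \oplus N_2 = H_{\mathcal A}, \qquad H_{\mathcal A} = {N_1'}^\perp \oplus N_1' \stackrel{D}{\longrightarrow} M_2' \tilde\oplus N_2' = H_{\mathcal A}$$ with respect to which $F, D$ have the matrices $\begin{pmatrix} F_1 & 0\\ 0 & F_4\end{pmatrix}$, $\begin{pmatrix} D_1 & 0\\ 0 & D_4\end{pmatrix}$, respectively, where $F_1, D_1$ are isomorphisms, $N_1$ is finitely generated, and in addition there exists some $\iota\in B^a(N_1', N_2)$ such that $\iota$ is an isomorphism onto its image. Then $\mathbf M_C^{\mathcal A} = \begin{pmatrix} F & C \\ 0 & D\end{pmatrix}\in\mathcal M\Phi_+(H_{\mathcal A}\oplus H_{\mathcal A})$ for some $C\in B^a(H_{\mathcal A})$.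
   Context: $\mathcal A$ is a unital $C^*$-algebra and $H_{\mathcal A} = \ell^2(\mathcal A)$ is the standard Hilbert $\mathcal A$-module. For Hilbert $\mathcal A$-modules $H,K$, $B^a(H,K)$ denotes the bounded adjointable $\mathcal A$-linear operators $H\to K$, and $B^a(H) = B^a(H,H)$. $\oplus$ is the orthogonal direct sum; $\tilde\oplus$ denotes a direct sum of closed submodules that need not be orthogonal. A Hilbert module is finitely generated if it equals the linear span (over $\mathbb C$ and $\mathcal A$) of a finite subset. An isomorphism is a bounded $\mathcal A$-linear bijection with bounded inverse. For a decomposition $H = M_1\tilde\oplus N_1 \stackrel{T}{\longrightarrow} M_2\tilde\oplus N_2 = H$ into closed submodules, saying $T$ has matrix $\begin{pmatrix} T_1 & 0\\ 0& T_4\end{pmatrix}$ means $T(M_1)\subseteq M_2$, $T(N_1)\subseteq N_2$, $T_1 = T|_{M_1}: M_1\to M_2$, $T_4 = T|_{N_1}:N_1\to N_2$. For $H = H_{\mathcal A}$ or $H_{\mathcal A}\oplus H_{\mathcal A}$, $T\in B^a(H)$ is upper semi-$\mathcal A$-Fredholm, $T\in\mathcal M\Phi_+(H)$, if there is such a decomposition with diagonal matrix, $T_1$ an isomorphism and $N_1$ finitely generated. *)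

theory Defs
  imports "HOL-Analysis.Analysis" "HOL-Library.Function_Algebras"
begin

text \<open>
  Unital $C^*$-algebras. Completeness and submultiplicativity of the norm come from
  \<^class>\<open>banach\<close> and \<^class>\<open>real_normed_algebra_1\<close>; the latter also gives
  \<open>1 \<noteq> 0\<close>. The axiom \<open>scaleR_scaleC\<close> makes the inherited real scalar multiplication
  the restriction of the complex one.
\<close>

class unital_cstar_algebra = real_normed_algebra_1 + banach +
  fixes scaleC :: "complex \<Rightarrow> 'a \<Rightarrow> 'a"
    and star :: "'a \<Rightarrow> 'a"
  assumes scaleC_add_right: "scaleC c (x + y) = scaleC c x + scaleC c y"
    and scaleC_add_left: "scaleC (c + d) x = scaleC c x + scaleC d x"
    and scaleC_scaleC: "scaleC c (scaleC d x) = scaleC (c * d) x"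
    and scaleR_scaleC: "scaleR r x = scaleC (complex_of_real r) x"
    and mult_scaleC_left: "scaleC c x * y = scaleC c (x * y)"
    and mult_scaleC_right: "x * scaleC c y = scaleC c (x * y)"
    and norm_scaleC: "norm (scaleC c x) = cmod c * norm x"
    and star_star: "star (star x) = x"
    and star_add: "star (x + y) = star x + star y"
    and star_scaleC: "star (scaleC c x) = scaleC (cnj c) (star x)"
    and star_mult: "star (x * y) = star y * star x"
    and norm_star_mult_self: "norm (star x * x) = (norm x)\<^sup>2"

text \<open>
  The data of a (right) Hilbert module over \<open>'a\<close>: a carrier inside a type \<open>'h\<close>, whose
  addition is that of \<open>'h\<close>, the action of \<open>'a\<close> and the \<open>'a\<close>-valued inner product, which is
  conjugate linear in the first variable. The Hilbert module axioms are not part of the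
  record; below, the record is only used for the standard module, orthogonal direct sums
  and closed submodules. As the algebra is unital, multiplication by a complex number \<open>c\<close>
  is the action of \<open>scaleC c 1\<close>, so that \<open>'a\<close>-linear maps are complex linear.

  Operators are functions on the ambient types, and only their values on the carrier matter.
\<close>

record ('a, 'h) hilbert_module =
  hm_carrier :: "'h set"
  hm_act :: "'h \<Rightarrow> 'a \<Rightarrow> 'h"
  hm_inner :: "'h \<Rightarrow> 'h \<Rightarrow> 'a"

definition hm_standard :: "('a::unital_cstar_algebra, nat \<Rightarrow> 'a) hilbert_module" where
  "hm_standard =
    \<lparr> hm_carrier = {x. summable (\<lambda>n. star (x n) * x n)},
      hm_act = (\<lambda>x a n. x n * a),
      hm_inner = (\<lambda>x y. \<Sum>n. star (x n) * y n) \<rparr>"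

definition hm_sum ::
  "('a::unital_cstar_algebra, 'h) hilbert_module \<Rightarrow> ('a, 'k) hilbert_module
    \<Rightarrow> ('a, 'h \<times> 'k) hilbert_module" where
  "hm_sum H K =
    \<lparr> hm_carrier = hm_carrier H \<times> hm_carrier K,
      hm_act = (\<lambda>x a. (hm_act H (fst x) a, hm_act K (snd x) a)),
      hm_inner = (\<lambda>x y. hm_inner H (fst x) (fst y) + hm_inner K (snd x) (snd y)) \<rparr>"

definition hm_restrict ::
  "('a, 'h) hilbert_module \<Rightarrow> 'h set \<Rightarrow> ('a, 'h) hilbert_module" where
  "hm_restrict H M = H\<lparr>hm_carrier := M\<rparr>"

definition hm_norm :: "('a::unital_cstar_algebra, 'h) hilbert_module \<Rightarrow> 'h \<Rightarrow> real" where
  "hm_norm H x = sqrt (norm (hm_inner H x x))"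


subsection \<open>Submodules and decompositions\<close>

definition hm_submodule ::
  "('a::unital_cstar_algebra, 'h::ab_group_add) hilbert_module \<Rightarrow> 'h set \<Rightarrow> bool" where
  "hm_submodule H M \<longleftrightarrow> M \<subseteq> hm_carrier H \<and> 0 \<in> M \<and>
    (\<forall>x\<in>M. \<forall>y\<in>M. x + y \<in> M) \<and> (\<forall>x\<in>M. \<forall>a. hm_act H x a \<in> M)"

definition hm_closed_submodule ::
  "('a::unital_cstar_algebra, 'h::ab_group_add) hilbert_module \<Rightarrow> 'h set \<Rightarrow> bool" where
  "hm_closed_submodule H M \<longleftrightarrow> hm_submodule H M \<and>
    (\<forall>x\<in>hm_carrier H. (\<forall>e>0. \<exists>y\<in>M. hm_norm H (x - y) < e) \<longrightarrow> x \<in> M)"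

definition hm_perp ::
  "('a::unital_cstar_algebra, 'h) hilbert_module \<Rightarrow> 'h set \<Rightarrow> 'h set" where
  "hm_perp H M = {x \<in> hm_carrier H. \<forall>y\<in>M. hm_inner H x y = 0}"

text \<open>The direct sum, not necessarily orthogonal, of two closed submodules.\<close>

definition hm_decomposition ::
  "('a::unital_cstar_algebra, 'h::ab_group_add) hilbert_module
    \<Rightarrow> 'h set \<Rightarrow> 'h set \<Rightarrow> bool" where
  "hm_decomposition H M N \<longleftrightarrow> hm_closed_submodule H M \<and> hm_closed_submodule H N \<and>
    M \<inter> N = {0} \<and> hm_carrier H = {m + n | m n. m \<in> M \<and> n \<in> N}"

definition hm_finitely_generated ::
  "('a::unital_cstar_algebra, 'h::ab_group_add) hilbert_module \<Rightarrow> bool" where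
  "hm_finitely_generated H \<longleftrightarrow> (\<exists>G. finite G \<and> G \<subseteq> hm_carrier H \<and>
    hm_carrier H = {\<Sum>g\<in>G. hm_act H g (a g) | a. True})"


subsection \<open>Operators\<close>

definition hm_linear ::
  "('a::unital_cstar_algebra, 'h::ab_group_add) hilbert_module
    \<Rightarrow> ('a, 'k::ab_group_add) hilbert_module \<Rightarrow> ('h \<Rightarrow> 'k) \<Rightarrow> bool" where
  "hm_linear H K T \<longleftrightarrow> T ` hm_carrier H \<subseteq> hm_carrier K \<and>
    (\<forall>x\<in>hm_carrier H. \<forall>y\<in>hm_carrier H. T (x + y) = T x + T y) \<and>
    (\<forall>x\<in>hm_carrier H. \<forall>a. T (hm_act H x a) = hm_act K (T x) a)"

definition hm_bounded ::
  "('a::unital_cstar_algebra, 'h) hilbert_module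
    \<Rightarrow> ('a, 'k) hilbert_module \<Rightarrow> ('h \<Rightarrow> 'k) \<Rightarrow> bool" where
  "hm_bounded H K T \<longleftrightarrow> (\<exists>B. \<forall>x\<in>hm_carrier H. hm_norm K (T x) \<le> B * hm_norm H x)"

definition hm_adjointable ::
  "('a::unital_cstar_algebra, 'h::ab_group_add) hilbert_module
    \<Rightarrow> ('a, 'k::ab_group_add) hilbert_module \<Rightarrow> ('h \<Rightarrow> 'k) set" where
  "hm_adjointable H K = {T. hm_linear H K T \<and> hm_bounded H K T \<and>
    (\<exists>S. S ` hm_carrier K \<subseteq> hm_carrier H \<and>
      (\<forall>x\<in>hm_carrier H. \<forall>y\<in>hm_carrier K. hm_inner K (T x) y = hm_inner H x (S y)))}"

definition hm_isomorphism ::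
  "('a::unital_cstar_algebra, 'h::ab_group_add) hilbert_module
    \<Rightarrow> ('a, 'k::ab_group_add) hilbert_module \<Rightarrow> ('h \<Rightarrow> 'k) \<Rightarrow> bool" where
  "hm_isomorphism H K T \<longleftrightarrow> hm_linear H K T \<and> hm_bounded H K T \<and>
    bij_betw T (hm_carrier H) (hm_carrier K) \<and>
    hm_bounded K H (inv_into (hm_carrier H) T)"

text \<open>
  \<open>T\<close> has a diagonal matrix with respect to the decompositions
  $H = M_1 \tilde\oplus N_1 \to M_2 \tilde\oplus N_2 = H$.
\<close>

definition hm_diagonal ::
  "('a::unital_cstar_algebra, 'h::ab_group_add) hilbert_module \<Rightarrow> ('h \<Rightarrow> 'h)
    \<Rightarrow> 'h set \<Rightarrow> 'h set \<Rightarrow> 'h set \<Rightarrow> 'h set \<Rightarrow> bool" where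
  "hm_diagonal H T M1 N1 M2 N2 \<longleftrightarrow>
    hm_decomposition H M1 N1 \<and> hm_decomposition H M2 N2 \<and> T ` M1 \<subseteq> M2 \<and> T ` N1 \<subseteq> N2"

definition upper_semi_fredholm ::
  "('a::unital_cstar_algebra, 'h::ab_group_add) hilbert_module \<Rightarrow> ('h \<Rightarrow> 'h) set" where
  "upper_semi_fredholm H = {T \<in> hm_adjointable H H. \<exists>M1 N1 M2 N2.
    hm_diagonal H T M1 N1 M2 N2 \<and>
    hm_isomorphism (hm_restrict H M1) (hm_restrict H M2) T \<and>
    hm_finitely_generated (hm_restrict H N1)}"

text \<open>The operator with matrix $\begin{pmatrix} F & C \cr 0 & D \end{pmatrix}$.\<close>

definition upper_triangular ::
  "('h \<Rightarrow> 'h) \<Rightarrow> ('k \<Rightarrow> 'h) \<Rightarrow> ('k \<Rightarrow> 'k) \<Rightarrow> 'h \<times> 'k \<Rightarrow> 'h::ab_group_add \<times> 'k" where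
  "upper_triangular F C D = (\<lambda>(x, y). (F x + C y, D y))"

end

theory Submission
  imports Defs
begin

text \<open>
  If both \<open>F\<close> and \<open>D\<close> are upper semi-Fredholm, then \<open>C = 0\<close> works. Otherwise \<open>C\<close> is the composition
  of \<open>\<iota>\<close> with the orthogonal projection onto \<open>N1'\<close>: it moves \<open>N1'\<close>, where \<open>D\<close> may fail to
  be injective, isomorphically into the complement \<open>N2\<close> of \<open>F M1\<close>. The decompositions for the
  resulting operator come from a bounded left inverse \<open>(\<iota>* \<iota>)\<^sup>-\<^sup>1 \<iota>*\<close> of \<open>\<iota>\<close>. The inverse of \<open>\<iota>* \<iota>\<close>
  exists by the continuity method, whose only analytic inputs are completeness of the modules, the
  Cauchy-Schwarz inequality and positivity of \<open>a* a\<close> in a C*-algebra.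
\<close>

section \<open>Positive elements of a unital C*-algebra\<close>

text \<open>Closed submodules of Hilbert modules need not be complemented, so a complement of
  \<open>\<iota> N1'\<close> inside \<open>N2\<close> has to be built; it is the kernel of the left
  inverse of \<open>\<iota>\<close>. With this choice \<open>F\<close> still maps \<open>N1\<close>
  into \<open>N2\<close>, but not necessarily into that kernel, so the obvious candidate
  \<open>N1 \<times> 0\<close> may fail to make the operator diagonal. Shearing it along the second
  coordinate repairs this: \<open>C\<close> reaches every element of \<open>\<iota> N1'\<close>, so
  a suitable second coordinate cancels the part of \<open>F n\<close> lying there, and the sheared
  module is still an image of \<open>N1\<close>, hence finitely generated. Orthogonality of the two
  sums with summands \<open>N2\<close> and \<open>N1'\<close> makes their projections self-adjoint,
  which is what gives \<open>C\<close> an adjoint. Positivity is encoded by a norm condition instead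
  of a spectrum. Square roots come from an iteration, and the comparison of norms of positive
  elements from writing commuting self-adjoint elements as real and imaginary parts of one element,
  so that no functional calculus enters.\<close>

lemma star_0 [simp]: "star 0 = (0::'a::unital_cstar_algebra)"
  using star_add[of 0 "0::'a"] by simp

lemma star_minus [simp]: "star (- x) = - star (x::'a::unital_cstar_algebra)"
  using star_add[of x "- x"] by (simp add: eq_neg_iff_add_eq_0 add.commute)

lemma star_diff: "star (x - y) = star x - star (y::'a::unital_cstar_algebra)"
  using star_add[of x "- y"] by simp

lemma star_one [simp]: "star 1 = (1::'a::unital_cstar_algebra)"
  by (metis mult_1 mult.right_neutral star_mult star_star)

lemma star_scaleR [simp]: "star (scaleR r x) = scaleR r (star (x::'a::unital_cstar_algebra))"
  by (simp add: scaleR_scaleC star_scaleC)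

text \<open>The C*-identity bounds the square of \<open>norm y\<close> by
  \<open>norm (star y) * norm y\<close>; cancelling, and using the result for both \<open>x\<close>
  and \<open>star x\<close>, leaves equality.\<close>

lemma norm_star [simp]: "norm (star x) = norm (x::'a::unital_cstar_algebra)"
proof -
  have *: "norm y \<le> norm (star y)" for y :: 'a
  proof (cases "y = 0")
    case False
    have "norm y * norm y \<le> norm (star y) * norm y"
      using norm_mult_ineq[of "star y" y] norm_star_mult_self[of y] by (simp add: power2_eq_square)
    then show ?thesis using False by simp
  qed simp
  show ?thesis using *[of x] *[of "star x"] by (simp add: star_star)
qed

lemma bounded_linear_star: "bounded_linear (star :: 'a::unital_cstar_algebra \<Rightarrow> 'a)"
  by (rule bounded_linear_intro[where K = 1]) (auto simp: star_add)

lemma norm_self_adjoint_square: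
  fixes x :: "'a::unital_cstar_algebra"
  assumes "star x = x"
  shows "norm (x * x) = (norm x)\<^sup>2"
  using norm_star_mult_self[of x] assms by simp

text \<open>For self-adjoint \<open>h\<close> the inequality says that the spectrum lies in the
  interval from 0 to \<open>2 * t\<close>, so this is ordinary positivity expressed by norms. With
  \<open>t\<close> existential, closure under addition is the triangle inequality;
  \<open>cstar_pos_norm_diff_le\<close> shows later that every \<open>t\<close> above the norm of a
  positive \<open>h\<close> works.\<close>

definition cstar_pos :: "'a::unital_cstar_algebra \<Rightarrow> bool" where
  "cstar_pos h \<longleftrightarrow> star h = h \<and> (\<exists>t. norm (scaleR t 1 - h) \<le> t)"

lemma cstar_posI: "star h = h \<Longrightarrow> norm (scaleR t 1 - h) \<le> t \<Longrightarrow> cstar_pos h"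
  by (auto simp: cstar_pos_def)

lemma cstar_pos_self_adjoint: "cstar_pos h \<Longrightarrow> star h = h"
  by (simp add: cstar_pos_def)

lemma cstar_pos_0 [simp]: "cstar_pos 0"
  by (rule cstar_posI[where t = 0]) auto

lemma cstar_pos_add:
  fixes h k :: "'a::unital_cstar_algebra"
  assumes "cstar_pos h" "cstar_pos k"
  shows "cstar_pos (h + k)"
proof -
  obtain s t where "norm (scaleR t 1 - h) \<le> t" "norm (scaleR s 1 - k) \<le> s"
    using assms by (auto simp: cstar_pos_def)
  moreover have "norm (scaleR (t + s) 1 - (h + k)) \<le> norm (scaleR t 1 - h) + norm (scaleR s 1 - k)"
    using norm_triangle_ineq[of "scaleR t 1 - h" "scaleR s 1 - k"] by (simp add: algebra_simps)
  ultimately show ?thesis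
    using assms by (intro cstar_posI[where t = "t + s"]) (auto simp: cstar_pos_def star_add)
qed

lemma cstar_pos_scaleR:
  fixes h :: "'a::unital_cstar_algebra"
  assumes "cstar_pos h" "0 \<le> r"
  shows "cstar_pos (scaleR r h)"
proof -
  obtain t where t: "norm (scaleR t 1 - h) \<le> t" using assms by (auto simp: cstar_pos_def)
  have "norm (scaleR (r * t) 1 - scaleR r h) = r * norm (scaleR t 1 - h)"
    using assms(2) by (metis abs_of_nonneg norm_scaleR scaleR_right_diff_distrib scaleR_scaleR)
  also have "\<dots> \<le> r * t" using t assms(2) by (rule mult_left_mono)
  finally show ?thesis using assms by (intro cstar_posI) (auto simp: cstar_pos_def)
qed

text \<open>
  The square root of \<open>1 - z\<close> is \<open>1 - y\<close> for a fixed point \<open>y\<close> of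
  \<open>y \<mapsto> (z + y\<^sup>2)/2\<close>. This map need not be a contraction on the unit ball, but its iterates
  are dominated by those of the scalar case \<open>z = 1\<close>, which increase to \<open>1\<close>.
\<close>

primrec sqrt_iter :: "'a::real_algebra_1 \<Rightarrow> nat \<Rightarrow> 'a" where
  "sqrt_iter z 0 = 0"
| "sqrt_iter z (Suc n) = scaleR (1/2) (z + sqrt_iter z n * sqrt_iter z n)"

text \<open>The map taking \<open>r\<close> to \<open>(1 + r * r) / 2\<close> is increasing on
  nonnegative reals, fixes 1, and sends 0 above itself. The clauses are proved together because
  monotonicity needs nonnegativity.\<close>

lemma sqrt_iter_scalar:
  "0 \<le> sqrt_iter (1::real) n \<and> sqrt_iter (1::real) n \<le> sqrt_iter 1 (Suc n) \<and> sqrt_iter (1::real) n \<le> 1"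
proof (induction n)
  case (Suc n)
  define r r' where "r = sqrt_iter (1::real) n" and "r' = sqrt_iter (1::real) (Suc n)"
  have r: "0 \<le> r" "r \<le> r'" "r \<le> 1" using Suc by (auto simp only: r_def r'_def)
  define a b where "a = r * r" and "b = r' * r'"
  have "a \<le> b" "a \<le> 1" "0 \<le> a"
    using r by (auto simp: a_def b_def intro: mult_mono mult_le_one)
  moreover have "r' = (1 + a) / 2" by (simp add: a_def r_def r'_def)
  moreover have "sqrt_iter (1::real) (Suc (Suc n)) = (1 + b) / 2"
    unfolding b_def r'_def by (subst sqrt_iter.simps(2)) (simp del: sqrt_iter.simps)
  ultimately show ?case unfolding r'_def[symmetric] by simp
qed simp

text \<open>Majorant method: the recursion has nonnegative coefficients, so norms of iterates and of
  their increments obey the scalar recursion as inequalities.\<close>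

lemma sqrt_iter_dominated:
  fixes z :: "'a::real_normed_algebra_1"
  assumes "norm z \<le> 1"
  shows "norm (sqrt_iter z n) \<le> sqrt_iter 1 n \<and>
    norm (sqrt_iter z (Suc n) - sqrt_iter z n) \<le> sqrt_iter 1 (Suc n) - sqrt_iter 1 n"
proof (induction n)
  case 0
  then show ?case using assms by simp
next
  case (Suc n)
  define y y' where "y = sqrt_iter z n" and "y' = sqrt_iter z (Suc n)"
  define r r' where "r = sqrt_iter (1::real) n" and "r' = sqrt_iter (1::real) (Suc n)"
  have IH: "norm y \<le> r" "norm (y' - y) \<le> r' - r" using Suc by (auto simp: y_def y'_def r_def r'_def)
  then have y': "norm y' \<le> r'" using norm_triangle_ineq2[of y' y] by linarith
  have "0 \<le> r" "r \<le> r'" using sqrt_iter_scalar[of n] by (auto simp: r_def r'_def)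
  \<comment> \<open>This splitting of a difference of squares is valid without commutativity, and
    its scalar counterpart is an equality.\<close>
  have "norm (y' * y' - y * y) = norm (y' * (y' - y) + (y' - y) * y)" by (simp add: algebra_simps)
  also have "\<dots> \<le> norm y' * norm (y' - y) + norm (y' - y) * norm y"
    by (intro order_trans[OF norm_triangle_ineq] add_mono norm_mult_ineq)
  also have "\<dots> \<le> r' * (r' - r) + (r' - r) * r"
    using IH y' \<open>0 \<le> r\<close> \<open>r \<le> r'\<close> by (intro add_mono mult_mono) auto
  also have "\<dots> = r' * r' - r * r" by (simp add: algebra_simps)
  finally have *: "norm (y' * y' - y * y) \<le> r' * r' - r * r" .
  have "sqrt_iter z (Suc (Suc n)) - y' = scaleR (1/2) (y' * y' - y * y)"
    unfolding y'_def y_def sqrt_iter.simps(2)[of z "Suc n"]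
    by (simp add: algebra_simps)
  moreover have "sqrt_iter 1 (Suc (Suc n)) - r' = (r' * r' - r * r) / 2"
    unfolding r'_def r_def sqrt_iter.simps(2)[of "1::real" "Suc n"] by (simp add: field_simps)
  ultimately show ?case using * y' by (simp add: y'_def r'_def del: sqrt_iter.simps)
qed

text \<open>The equation is a form of \<open>(1 - y) * (1 - y) = 1 - z\<close>. The iterates are
  real polynomials in \<open>z\<close>, so self-adjointness and commutation with everything
  commuting with \<open>z\<close> hold for each of them and survive the limit.\<close>

lemma sqrt_iter_fixed_point:
  fixes z :: "'a::unital_cstar_algebra"
  assumes "norm z \<le> 1" "star z = z"
  obtains y where "y + y = z + y * y" "norm y \<le> 1" "star y = y"
    "\<And>w. w * z = z * w \<Longrightarrow> w * y = y * w"
proof -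
  let ?r = "sqrt_iter (1::real)"
  have "incseq ?r" using sqrt_iter_scalar by (intro incseq_SucI) auto
  moreover have "?r n \<le> 1" for n using sqrt_iter_scalar by blast
  ultimately obtain l where "?r \<longlonglongrightarrow> l" using incseq_convergent by metis
  \<comment> \<open>The increments of the convergent scalar iteration are summable and dominate
    those for \<open>z\<close>, so the telescoping series converges absolutely.\<close>
  then have "summable (\<lambda>n. ?r (Suc n) - ?r n)" by (rule telescope_summable)
  then have "summable (\<lambda>n. sqrt_iter z (Suc n) - sqrt_iter z n)"
    by (rule summable_comparison_test'[where N = 0])
      (rule conjunct2[OF sqrt_iter_dominated[OF assms(1)]])
  then have "convergent (\<lambda>n. \<Sum>k<n. sqrt_iter z (Suc k) - sqrt_iter z k)"
    by (simp only: summable_iff_convergent)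
  then obtain y where "(\<lambda>n. \<Sum>k<n. sqrt_iter z (Suc k) - sqrt_iter z k) \<longlonglongrightarrow> y"
    by (auto simp: convergent_def)
  then have y: "sqrt_iter z \<longlonglongrightarrow> y"
    by (simp only: sum_lessThan_telescope sqrt_iter.simps(1) diff_zero)
  show ?thesis
  proof
    have "(\<lambda>n. sqrt_iter z (Suc n)) \<longlonglongrightarrow> y" by (rule LIMSEQ_Suc[OF y])
    moreover have "(\<lambda>n. sqrt_iter z (Suc n)) \<longlonglongrightarrow> scaleR (1/2) (z + y * y)"
      using y by (auto intro!: tendsto_intros)
    ultimately have "y = scaleR (1/2) (z + y * y)" by (rule LIMSEQ_unique)
    then have "scaleR 2 y = scaleR 2 (scaleR (1/2) (z + y * y))" by (rule arg_cong)
    then show "y + y = z + y * y" by (simp add: scaleR_2[symmetric])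
    have "norm (sqrt_iter z n) \<le> 1" for n
      using sqrt_iter_dominated[OF assms(1), of n] sqrt_iter_scalar[of n] by linarith
    then show "norm y \<le> 1" using y by (auto intro: Lim_norm_ubound[OF sequentially_bot])
    have "star (sqrt_iter z n) = sqrt_iter z n" for n
      by (induction n) (auto simp: star_add star_mult assms)
    then show "star y = y"
      using bounded_linear.tendsto[OF bounded_linear_star y] y LIMSEQ_unique by simp
    show "w * y = y * w" if "w * z = z * w" for w
    proof -
      have "w * sqrt_iter z n = sqrt_iter z n * w" for n
      proof (induction n)
        case (Suc n)
        have "w * (sqrt_iter z n * sqrt_iter z n) = sqrt_iter z n * sqrt_iter z n * w"
          using Suc by (simp add: mult.assoc[symmetric]) (simp add: mult.assoc)
        then show ?case using that by (simp add: distrib_left distrib_right)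
      qed simp
      moreover have "(\<lambda>n. w * sqrt_iter z n) \<longlonglongrightarrow> w * y" using y by (intro tendsto_intros)
      moreover have "(\<lambda>n. sqrt_iter z n * w) \<longlonglongrightarrow> y * w" using y by (intro tendsto_intros)
      ultimately show ?thesis using LIMSEQ_unique by auto
    qed
  qed
qed

text \<open>A witness \<open>t > 0\<close> of positivity makes \<open>h / t\<close> equal to
  \<open>1 - z\<close> with \<open>norm z \<le> 1\<close>, where the iteration applies. The last
  clause is kept because later arguments need roots of commuting elements to commute.\<close>

lemma cstar_pos_sqrt:
  fixes h :: "'a::unital_cstar_algebra"
  assumes "cstar_pos h"
  obtains b where "b * b = h" "cstar_pos b" "\<And>w. w * h = h * w \<Longrightarrow> w * b = b * w"
proof -
  obtain t where t: "norm (scaleR t 1 - h) \<le> t" and sa: "star h = h"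
    using assms by (auto simp: cstar_pos_def)
  have "0 \<le> t" using t norm_ge_zero order_trans by blast
  show ?thesis
  proof (cases "t = 0")
    case True
    then have "h = 0" using t by simp
    then show ?thesis using that[of 0] by simp
  next
    case False
    with \<open>0 \<le> t\<close> have "t > 0" by simp
    define z where "z = 1 - scaleR (1/t) h"
    have "z = scaleR (1/t) (scaleR t 1 - h)" using \<open>t > 0\<close> by (simp add: z_def scaleR_right_diff_distrib)
    then have "norm z \<le> 1" using t \<open>t > 0\<close> by simp
    moreover have "star z = z" by (simp add: z_def star_diff sa)
    ultimately obtain y where y: "y + y = z + y * y" "norm y \<le> 1" "star y = y"
      "\<And>w. w * z = z * w \<Longrightarrow> w * y = y * w" using sqrt_iter_fixed_point by blast
    define b where "b = scaleR (sqrt t) (1 - y)"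
    have "(1 - y) * (1 - y) = 1 - (y + y) + y * y" by (simp add: algebra_simps)
    also have "\<dots> = scaleR (1/t) h" by (simp add: y(1) z_def)
    finally have "b * b = h" using \<open>t > 0\<close> by (simp add: b_def)
    \<comment> \<open>The bound \<open>norm y \<le> 1\<close> is exactly the witness 1 for
      positivity of \<open>1 - y\<close>.\<close>
    moreover have "cstar_pos b" unfolding b_def
      using \<open>t > 0\<close> y(2,3) by (intro cstar_pos_scaleR cstar_posI[where t = 1]) (auto simp: star_diff)
    moreover have "w * b = b * w" if "w * h = h * w" for w
    proof -
      have "w * z = z * w" using that by (simp add: z_def algebra_simps)
      from y(4)[OF this] show ?thesis by (simp add: b_def algebra_simps)
    qed
    ultimately show ?thesis using that by blast
  qed
qed

text \<open>Since \<open>p\<close> and \<open>q\<close> commute, \<open>u = p + i q\<close>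
  satisfies \<open>star u * u = p * p + q * q\<close>, so the C*-identity gives the norm of
  \<open>u\<close>. The norm of \<open>p\<close>, its real part, is no larger.\<close>

lemma norm_le_of_sum_squares:
  fixes p q :: "'a::unital_cstar_algebra"
  assumes "star p = p" "star q = q" "p * q = q * p" "p * p + q * q = scaleR t 1"
    and "0 \<le> t"
  shows "norm (p * p) \<le> t"
proof -
  define u where "u = p + scaleC \<i> q"
  have scc: "scaleC c (- x) = - scaleC c x" for c and x :: 'a
    using scaleC_add_right[of c "- x" x] scaleC_add_right[of c 0 "0::'a"]
    by (simp add: eq_neg_iff_add_eq_0)
  have scd: "scaleC c (x - y) = scaleC c x - scaleC c y" for c and x y :: 'a
    using scaleC_add_right[of c x "- y"] by (simp add: scc)
  have m1: "scaleC (-1) x = - x" for x :: 'a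
    using scaleR_scaleC[of "-1" x] by simp
  have mi: "scaleC (- \<i>) x = - scaleC \<i> x" for x :: 'a
    using scaleC_scaleC[of "-1" "\<i>" x] m1 by simp
  have su: "star u = p - scaleC \<i> q"
    using assms by (simp add: u_def star_add star_scaleC mi)
  have "star u * u = p * p + q * q"
    unfolding su unfolding u_def using assms(3)
    by (simp add: algebra_simps mult_scaleC_left mult_scaleC_right scaleC_scaleC scd m1)
  then have n: "(norm u)\<^sup>2 = t" using norm_star_mult_self[of u] assms(4,5) by simp
  have "scaleR 2 p = u + star u" unfolding su by (simp add: u_def scaleR_2)
  then have "2 * norm p \<le> 2 * norm u"
    by (metis abs_numeral norm_scaleR norm_star norm_triangle_ineq mult_2)
  then have "(norm p)\<^sup>2 \<le> (norm u)\<^sup>2" by (intro power_mono) auto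
  then show ?thesis using n norm_self_adjoint_square[OF assms(1)] by simp
qed

text \<open>The element \<open>t - b * b\<close> is positive with witness \<open>t\<close>, since
  subtracting it from \<open>t\<close> gives back \<open>b * b\<close>. Its root \<open>c\<close>
  commutes with \<open>b\<close>, and the squares of \<open>b\<close> and \<open>c\<close> sum to
  \<open>t\<close>.\<close>

lemma cstar_pos_square:
  fixes b :: "'a::unital_cstar_algebra"
  assumes b: "star b = b" and t: "norm (b * b) \<le> t"
  shows "norm (scaleR t 1 - b * b) \<le> t"
proof -
  have "norm (scaleR t 1 - (scaleR t 1 - b * b)) \<le> t" using t by simp
  then have pos: "cstar_pos (scaleR t 1 - b * b)"
    using b by (intro cstar_posI[where t = t]) (auto simp: star_diff star_mult)
  obtain c where c: "c * c = scaleR t 1 - b * b" "cstar_pos c"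
    "\<And>w. w * (scaleR t 1 - b * b) = (scaleR t 1 - b * b) * w \<Longrightarrow> w * c = c * w"
    using cstar_pos_sqrt[OF pos] by blast
  have "b * c = c * b" by (rule c(3)) (simp add: algebra_simps)
  moreover have "0 \<le> t" using t norm_ge_zero order_trans by blast
  ultimately have "norm (c * c) \<le> t"
    using c(1) cstar_pos_self_adjoint[OF c(2)] b
    by (intro norm_le_of_sum_squares[of c b]) auto
  then show ?thesis using c(1) by simp
qed

text \<open>Frees positivity from its unknown witness: writing \<open>h\<close> as the square of a
  self-adjoint root reduces the claim to squares.\<close>

lemma cstar_pos_norm_diff_le:
  fixes h :: "'a::unital_cstar_algebra"
  assumes "cstar_pos h" "norm h \<le> t"
  shows "norm (scaleR t 1 - h) \<le> t"
proof -
  obtain b where b: "b * b = h" "cstar_pos b" using cstar_pos_sqrt[OF assms(1)] by blast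
  show ?thesis using cstar_pos_square[of b t] assms(2) cstar_pos_self_adjoint[OF b(2)] b(1) by simp
qed

lemma cstar_pos_scaleR_one_diff:
  fixes h :: "'a::unital_cstar_algebra"
  assumes "cstar_pos h" "norm h \<le> t"
  shows "cstar_pos (scaleR t 1 - h)"
  using assms cstar_pos_self_adjoint[OF assms(1)]
  by (intro cstar_posI[where t = t]) (auto simp: star_diff)

text \<open>Take roots \<open>b\<close> of \<open>h\<close> and \<open>c\<close> of
  \<open>t - h\<close>. As \<open>b\<close> commutes with \<open>h = b * b\<close>, it commutes with
  \<open>c\<close>, and the two squares sum to \<open>t\<close>.\<close>

lemma cstar_pos_norm_le:
  fixes h :: "'a::unital_cstar_algebra"
  assumes "cstar_pos h" "cstar_pos (scaleR t 1 - h)" "0 \<le> t"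
  shows "norm h \<le> t"
proof -
  obtain b where b: "b * b = h" "cstar_pos b" "\<And>w. w * h = h * w \<Longrightarrow> w * b = b * w"
    using cstar_pos_sqrt[OF assms(1)] by blast
  obtain c where c: "c * c = scaleR t 1 - h" "cstar_pos c"
    "\<And>w. w * (scaleR t 1 - h) = (scaleR t 1 - h) * w \<Longrightarrow> w * c = c * w"
    using cstar_pos_sqrt[OF assms(2)] by blast
  have "b * h = h * b" using b(1) by (metis mult.assoc)
  then have "b * c = c * b" by (intro c(3)) (simp add: algebra_simps)
  then have "norm (b * b) \<le> t"
    using assms(3) b(1) c(1) cstar_pos_self_adjoint[OF b(2)] cstar_pos_self_adjoint[OF c(2)]
    by (intro norm_le_of_sum_squares[of b c]) auto
  then show ?thesis using b(1) by simp
qed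

text \<open>In the order of positive elements \<open>h\<close> lies below \<open>h + k\<close>,
  which lies below its own norm. Most norm estimates for inner products below reduce to
  this.\<close>

lemma cstar_pos_norm_mono:
  fixes h k :: "'a::unital_cstar_algebra"
  assumes "cstar_pos h" "cstar_pos k"
  shows "norm h \<le> norm (h + k)"
proof (rule cstar_pos_norm_le[OF assms(1)])
  have "cstar_pos (scaleR (norm (h + k)) 1 - (h + k) + k)"
    using assms by (intro cstar_pos_add cstar_pos_scaleR_one_diff) auto
  then show "cstar_pos (scaleR (norm (h + k)) 1 - h)" by simp
qed simp

lemma cstar_pos_squareI:
  fixes b :: "'a::unital_cstar_algebra"
  assumes "star b = b"
  shows "cstar_pos (b * b)"
  using cstar_pos_square[OF assms order_refl] assms by (intro cstar_posI) (auto simp: star_mult)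

section \<open>Sums, limits and hermitian squares\<close>

lemma cstar_pos_sum:
  fixes f :: "'i \<Rightarrow> 'a::unital_cstar_algebra"
  shows "(\<And>i. i \<in> I \<Longrightarrow> cstar_pos (f i)) \<Longrightarrow> cstar_pos (\<Sum>i\<in>I. f i)"
  by (induction I rule: infinite_finite_induct) (auto intro: cstar_pos_add)

text \<open>The witnesses may differ from term to term, but a convergent sequence is bounded and any
  common bound is a witness for all terms; the resulting condition is closed.\<close>

lemma cstar_pos_lim:
  fixes f :: "nat \<Rightarrow> 'a::unital_cstar_algebra"
  assumes "f \<longlonglongrightarrow> l" "\<And>n. cstar_pos (f n)"
  shows "cstar_pos l"
proof -
  obtain t where t: "\<And>n. norm (f n) \<le> t"
    using convergent_imp_Bseq[of f] assms(1) by (auto simp: convergent_def Bseq_def)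
  have "norm (scaleR t 1 - f n) \<le> t" for n
    using cstar_pos_norm_diff_le[OF assms(2) t] .
  moreover have "(\<lambda>n. scaleR t 1 - f n) \<longlonglongrightarrow> scaleR t 1 - l"
    using assms(1) by (intro tendsto_intros)
  ultimately have "norm (scaleR t 1 - l) \<le> t" by (auto intro: Lim_norm_ubound[OF sequentially_bot])
  moreover have "(\<lambda>n. star (f n)) \<longlonglongrightarrow> star l"
    using bounded_linear.tendsto[OF bounded_linear_star assms(1)] .
  then have "f \<longlonglongrightarrow> star l" by (simp add: cstar_pos_self_adjoint[OF assms(2)])
  then have "star l = l" using assms(1) LIMSEQ_unique by blast
  ultimately show ?thesis by (rule cstar_posI[rotated])
qed

text \<open>
  With \<open>k = - star b * b\<close> and \<open>m = b * star b\<close> both positive of norm \<open>\<beta>\<close> and \<open>t = \<beta>\<close>, the norm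
  of \<open>(t + m)\<^sup>2 = t\<^sup>2 + tm + b (t - k) star b\<close> is \<open>(t + \<beta>)\<^sup>2\<close>, but at most \<open>t\<^sup>2 + 2t\<beta>\<close>.
\<close>

lemma cstar_pos_minus_star_mult_self_imp_0:
  fixes b :: "'a::unital_cstar_algebra"
  assumes "cstar_pos (- (star b * b))"
  shows "b = 0"
proof -
  \<comment> \<open>Up to sign, \<open>p\<close> and \<open>q\<close> are twice the real and
    imaginary parts of \<open>b\<close>. Their squares sum to \<open>2 * (m + star b * b)\<close>,
    which exhibits \<open>m\<close> as a sum of positive elements.\<close>
  define p where "p = b + star b"
  define q where "q = scaleC \<i> (b - star b)"
  define \<beta> where "\<beta> = (norm b)\<^sup>2"
  define m where "m = b * star b"
  define e where "e = scaleR \<beta> 1 + m"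
  have sp: "star p = p" by (simp add: p_def star_add star_star add.commute)
  have m1: "scaleC (-1) x = - x" for x :: 'a
    using scaleR_scaleC[of "-1" x] by simp
  have mi: "scaleC (- \<i>) x = scaleC \<i> (- x)" for x :: 'a
    using scaleC_scaleC[of \<i> "-1" x] m1[of x] by simp
  have sq: "star q = q" by (simp add: q_def star_scaleC star_diff star_star mi)
  have "q * q = - ((b - star b) * (b - star b))"
    by (simp add: q_def mult_scaleC_left mult_scaleC_right scaleC_scaleC m1)
  then have "p * p + q * q = scaleR 2 (m + star b * b)"
    by (simp add: p_def m_def algebra_simps scaleR_2)
  then have "m = scaleR (1/2) (p * p + q * q) + - (star b * b)" by simp
  also have "cstar_pos \<dots>"
    using assms sp sq by (intro cstar_pos_add cstar_pos_scaleR cstar_pos_squareI) auto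
  finally have m: "cstar_pos m" .
  have nm: "norm m = \<beta>" using norm_star_mult_self[of "star b"] by (simp add: m_def \<beta>_def star_star)
  have nk: "norm (- (star b * b)) = \<beta>" using norm_star_mult_self[of b] by (simp add: \<beta>_def)
  have "0 \<le> \<beta>" by (simp add: \<beta>_def)
  have se: "star e = e" using cstar_pos_self_adjoint[OF m] by (simp add: e_def star_add)
  have posb: "cstar_pos (scaleR \<beta> 1)" using \<open>0 \<le> \<beta>\<close> by (intro cstar_posI[where t = \<beta>]) auto
  have "\<beta> \<le> norm e"
    using cstar_pos_norm_mono[OF posb m] \<open>0 \<le> \<beta>\<close> by (simp add: e_def)
  \<comment> \<open>Removing the summand \<open>\<beta>\<close> from \<open>e\<close> shows that
    \<open>m\<close> lies below \<open>norm e - \<beta>\<close>. As \<open>m\<close> has norm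
    \<open>\<beta>\<close>, the norm of \<open>e\<close> is at least
    \<open>2 * \<beta>\<close>.\<close>
  have "cstar_pos (scaleR (norm e) 1 - e)"
    unfolding e_def using posb m by (intro cstar_pos_scaleR_one_diff cstar_pos_add) auto
  then have "cstar_pos (scaleR (norm e - \<beta>) 1 - m)" by (simp add: e_def algebra_simps)
  then have "\<beta> \<le> norm e - \<beta>" using cstar_pos_norm_le[OF m] \<open>\<beta> \<le> norm e\<close> nm by simp
  then have "(2 * \<beta>)\<^sup>2 \<le> (norm e)\<^sup>2" using \<open>0 \<le> \<beta>\<close> by (intro power_mono) auto
  also have "\<dots> = norm (e * e)" using norm_self_adjoint_square[OF se] by simp
  also have "e * e = scaleR (\<beta> * \<beta>) 1 + scaleR \<beta> m + b * (scaleR \<beta> 1 - - (star b * b)) * star b"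
    by (simp add: e_def m_def algebra_simps)
  also have "norm \<dots> \<le> \<beta> * \<beta> + \<beta> * \<beta> + norm b * \<beta> * norm b"
  proof (intro norm_triangle_mono)
    show "norm (scaleR (\<beta> * \<beta>) (1::'a)) \<le> \<beta> * \<beta>" by simp
    show "norm (scaleR \<beta> m) \<le> \<beta> * \<beta>" using nm \<open>0 \<le> \<beta>\<close> by simp
    have "norm (b * (scaleR \<beta> 1 - - (star b * b)) * star b)
      \<le> norm b * norm (scaleR \<beta> 1 - - (star b * b)) * norm (star b)"
      by (intro order_trans[OF norm_mult_ineq] mult_right_mono norm_mult_ineq) auto
    also have "\<dots> \<le> norm b * \<beta> * norm b"
      using cstar_pos_norm_diff_le[OF assms, of \<beta>] nk
      by (simp only: norm_star) (intro mult_right_mono mult_left_mono, auto)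
    finally show "norm (b * (scaleR \<beta> 1 - - (star b * b)) * star b) \<le> norm b * \<beta> * norm b" .
  qed
  also have "\<dots> = 3 * \<beta>\<^sup>2" by (simp add: \<beta>_def power2_eq_square)
  finally have "\<beta>\<^sup>2 \<le> 0" by (simp add: power_mult_distrib)
  then have "\<beta> = 0" by simp
  then show ?thesis by (simp add: \<beta>_def)
qed

text \<open>Let \<open>s\<close> be the absolute value of \<open>h\<close>, so that
  \<open>q = s - h\<close> is twice the negative part. Then \<open>h * q = - (s * q)\<close>, and
  with \<open>r * r = s\<close> the hermitian square of \<open>a * q\<close> is minus the square of
  \<open>r * q\<close>. The preceding lemma forces \<open>a * q = 0\<close>, hence
  \<open>q = 0\<close> and \<open>h = s\<close>.\<close>

theorem cstar_pos_star_mult_self: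
  fixes a :: "'a::unital_cstar_algebra"
  shows "cstar_pos (star a * a)"
proof -
  define h where "h = star a * a"
  have sh: "star h = h" by (simp add: h_def star_mult star_star)
  obtain s where s: "s * s = h * h" "cstar_pos s" "\<And>w. w * (h * h) = h * h * w \<Longrightarrow> w * s = s * w"
    using cstar_pos_sqrt[OF cstar_pos_squareI[OF sh]] by blast
  obtain r where r: "r * r = s" "cstar_pos r" "\<And>w. w * s = s * w \<Longrightarrow> w * r = r * w"
    using cstar_pos_sqrt[OF s(2)] by blast
  note ss = cstar_pos_self_adjoint[OF s(2)] and sr = cstar_pos_self_adjoint[OF r(2)]
  have hs: "h * s = s * h" by (rule s(3)) (simp add: mult.assoc)
  define q where "q = s - h"
  have sq: "star q = q" by (simp add: q_def star_diff ss sh)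
  have "q * s = s * q" by (simp add: q_def algebra_simps hs)
  then have qr: "q * r = r * q" by (rule r(3))
  have hq: "h * q = - (s * q)" by (simp add: q_def algebra_simps hs s(1))
  have "star (a * q) * (a * q) = q * (h * q)" by (simp add: star_mult sq h_def mult.assoc)
  also have "\<dots> = - (q * s * q)" by (simp add: hq mult.assoc)
  also have "q * s * q = (r * q) * (r * q)" unfolding r(1)[symmetric] by (metis mult.assoc qr)
  finally have bb: "- (star (a * q) * (a * q)) = (r * q) * (r * q)" by simp
  moreover have "star (r * q) = r * q" by (simp add: star_mult sq sr qr)
  ultimately have "a * q = 0"
    using cstar_pos_squareI by (intro cstar_pos_minus_star_mult_self_imp_0) simp
  then have "h * q = 0" by (simp add: h_def mult.assoc)
  then have "q * q = s * q" by (simp add: q_def left_diff_distrib)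
  then have "q * q = 0" using hq \<open>h * q = 0\<close> by simp
  then have "q = 0" using norm_self_adjoint_square[OF sq] by simp
  then show ?thesis using s(2) by (simp add: q_def h_def)
qed

section \<open>Hilbert modules\<close>

lemma hm_restrict_simps [simp]:
  "hm_carrier (hm_restrict H M) = M"
  "hm_act (hm_restrict H M) = hm_act H"
  "hm_inner (hm_restrict H M) = hm_inner H"
  "hm_norm (hm_restrict H M) = hm_norm H"
  by (auto simp: hm_restrict_def hm_norm_def)

lemma hm_sum_simps [simp]:
  "hm_carrier (hm_sum H K) = hm_carrier H \<times> hm_carrier K"
  "hm_act (hm_sum H K) z a = (hm_act H (fst z) a, hm_act K (snd z) a)"
  "hm_inner (hm_sum H K) z w = hm_inner H (fst z) (fst w) + hm_inner K (snd z) (snd w)"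
  by (auto simp: hm_sum_def)

lemma hm_norm_nonneg [simp]: "0 \<le> hm_norm H x"
  by (simp add: hm_norm_def)

lemma hm_norm_power2: "(hm_norm H x)\<^sup>2 = norm (hm_inner H x x)"
  by (simp add: hm_norm_def)

lemma hm_bounded_nonneg:
  assumes "hm_bounded H K T"
  obtains B where "0 \<le> B" "\<And>x. x \<in> hm_carrier H \<Longrightarrow> hm_norm K (T x) \<le> B * hm_norm H x"
proof -
  obtain B where B: "\<And>x. x \<in> hm_carrier H \<Longrightarrow> hm_norm K (T x) \<le> B * hm_norm H x"
    using assms by (auto simp: hm_bounded_def)
  show ?thesis
  proof (rule that[of "\<bar>B\<bar>"])
    show "hm_norm K (T x) \<le> \<bar>B\<bar> * hm_norm H x" if "x \<in> hm_carrier H" for x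
      using B[OF that] mult_right_mono[OF abs_ge_self[of B] hm_norm_nonneg[of H x]] by linarith
  qed simp
qed

text \<open>The inner product may be degenerate: this covers the partial sums of the inner product of
  \<open>hm_standard\<close>.\<close>

locale semi_hilbert_module =
  fixes H :: "('a::unital_cstar_algebra, 'h::ab_group_add) hilbert_module"
  assumes zero_mem [simp]: "0 \<in> hm_carrier H"
    and add_mem: "x \<in> hm_carrier H \<Longrightarrow> y \<in> hm_carrier H \<Longrightarrow> x + y \<in> hm_carrier H"
    and act_mem: "x \<in> hm_carrier H \<Longrightarrow> hm_act H x a \<in> hm_carrier H"
    and act_minus_one: "x \<in> hm_carrier H \<Longrightarrow> hm_act H x (- 1) = - x"
    and act_add_left: "x \<in> hm_carrier H \<Longrightarrow> y \<in> hm_carrier H \<Longrightarrow>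
      hm_act H (x + y) a = hm_act H x a + hm_act H y a"
    and act_add_right: "x \<in> hm_carrier H \<Longrightarrow> hm_act H x (a + b) = hm_act H x a + hm_act H x b"
    and act_act: "x \<in> hm_carrier H \<Longrightarrow> hm_act H (hm_act H x a) b = hm_act H x (a * b)"
    and inner_add_right: "x \<in> hm_carrier H \<Longrightarrow> y \<in> hm_carrier H \<Longrightarrow> z \<in> hm_carrier H \<Longrightarrow>
      hm_inner H x (y + z) = hm_inner H x y + hm_inner H x z"
    and inner_act_right: "x \<in> hm_carrier H \<Longrightarrow> y \<in> hm_carrier H \<Longrightarrow>
      hm_inner H x (hm_act H y a) = hm_inner H x y * a"
    and star_inner: "x \<in> hm_carrier H \<Longrightarrow> y \<in> hm_carrier H \<Longrightarrow>
      star (hm_inner H x y) = hm_inner H y x"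
    and inner_pos: "x \<in> hm_carrier H \<Longrightarrow> cstar_pos (hm_inner H x x)"
begin

section \<open>Rules for the action and the inner product\<close>

lemma minus_mem: "x \<in> hm_carrier H \<Longrightarrow> - x \<in> hm_carrier H"
  using act_mem[of x "- 1"] act_minus_one by simp

lemma diff_mem: "x \<in> hm_carrier H \<Longrightarrow> y \<in> hm_carrier H \<Longrightarrow> x - y \<in> hm_carrier H"
  using add_mem[of x "- y"] minus_mem by simp

lemma act_zero_left [simp]: "hm_act H 0 a = 0"
  using act_add_left[of 0 0 a] by simp

lemma act_zero_right: "x \<in> hm_carrier H \<Longrightarrow> hm_act H x 0 = 0"
  using act_add_right[of x 0 0] by simp

lemma act_diff_left:
  "x \<in> hm_carrier H \<Longrightarrow> y \<in> hm_carrier H \<Longrightarrow> hm_act H (x - y) a = hm_act H x a - hm_act H y a"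
  using act_add_left[of "x - y" y a] diff_mem by simp

lemma act_sum_right:
  "x \<in> hm_carrier H \<Longrightarrow> hm_act H x (sum f A) = (\<Sum>i\<in>A. hm_act H x (f i))"
  by (induction A rule: infinite_finite_induct) (auto simp: act_add_right act_zero_right)

text \<open>The axioms fix the action of \<open>- 1\<close>; additivity in the scalar transfers this
  to \<open>1\<close>.\<close>

lemma act_one: "x \<in> hm_carrier H \<Longrightarrow> hm_act H x 1 = x"
proof -
  assume x: "x \<in> hm_carrier H"
  have "hm_act H x 1 + hm_act H x (- 1) = 0"
    using act_add_right[OF x, of 1 "- 1"] act_zero_right[OF x] by simp
  then show ?thesis using act_minus_one[OF x] by simp
qed

lemma sum_mem: "(\<And>i. i \<in> A \<Longrightarrow> f i \<in> hm_carrier H) \<Longrightarrow> sum f A \<in> hm_carrier H"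
  by (induction A rule: infinite_finite_induct) (auto intro: add_mem)

lemma inner_minus_right:
  assumes "x \<in> hm_carrier H" "y \<in> hm_carrier H"
  shows "hm_inner H x (- y) = - hm_inner H x y"
  using inner_act_right[OF assms, of "- 1"] act_minus_one[OF assms(2)] by simp

lemma inner_zero_right: "x \<in> hm_carrier H \<Longrightarrow> hm_inner H x 0 = 0"
  using inner_add_right[of x 0 0] by simp

lemma inner_diff_right:
  "x \<in> hm_carrier H \<Longrightarrow> y \<in> hm_carrier H \<Longrightarrow> z \<in> hm_carrier H \<Longrightarrow>
    hm_inner H x (y - z) = hm_inner H x y - hm_inner H x z"
  using inner_add_right[of x y "- z"] by (simp add: minus_mem inner_minus_right)

lemma inner_zero_left: "x \<in> hm_carrier H \<Longrightarrow> hm_inner H 0 x = 0"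
  using star_inner[of x 0] by (simp add: inner_zero_right)

lemma inner_add_left:
  "x \<in> hm_carrier H \<Longrightarrow> y \<in> hm_carrier H \<Longrightarrow> z \<in> hm_carrier H \<Longrightarrow>
    hm_inner H (y + z) x = hm_inner H y x + hm_inner H z x"
  using arg_cong[of _ _ star, OF inner_add_right[of x y z]] by (simp add: star_add star_inner add_mem)

lemma inner_minus_left:
  "x \<in> hm_carrier H \<Longrightarrow> y \<in> hm_carrier H \<Longrightarrow> hm_inner H (- y) x = - hm_inner H y x"
  using arg_cong[of _ _ star, OF inner_minus_right[of x y]] by (simp add: star_inner minus_mem)

lemma inner_diff_left:
  "x \<in> hm_carrier H \<Longrightarrow> y \<in> hm_carrier H \<Longrightarrow> z \<in> hm_carrier H \<Longrightarrow>
    hm_inner H (y - z) x = hm_inner H y x - hm_inner H z x"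
  using inner_add_left[of x y "- z"] by (simp add: minus_mem inner_minus_left)

lemma inner_act_left:
  "x \<in> hm_carrier H \<Longrightarrow> y \<in> hm_carrier H \<Longrightarrow>
    hm_inner H (hm_act H y a) x = star a * hm_inner H y x"
  using arg_cong[of _ _ star, OF inner_act_right[of x y a]] by (simp add: star_mult star_inner act_mem)

text \<open>For \<open>X > norm p\<close>, positivity of the inner square of
  \<open>x (r / X) - y\<close> combined with \<open>p\<close> lying below \<open>X\<close> leaves
  \<open>star r * r / X\<close> below \<open>q\<close>. Norms are then compared and \<open>X\<close>
  is lowered to \<open>norm p\<close>.\<close>

theorem Cauchy_Schwarz:
  assumes x: "x \<in> hm_carrier H" and y: "y \<in> hm_carrier H"
  shows "norm (hm_inner H x y) \<le> hm_norm H x * hm_norm H y"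
proof -
  define p q r where "p = hm_inner H x x" and "q = hm_inner H y y" and "r = hm_inner H x y"
  \<comment> \<open>The strict inequality keeps \<open>X\<close> positive even when
    \<open>p = 0\<close>, so that division is legitimate.\<close>
  have *: "(norm r)\<^sup>2 \<le> X * norm q" if X: "norm p < X" for X
  proof -
    have "X > 0" using X norm_ge_zero le_less_trans by blast
    define z where "z = hm_act H x (scaleR (1/X) r) - y"
    have zC: "hm_act H x (scaleR (1/X) r) \<in> hm_carrier H" by (intro act_mem x)
    have "z \<in> hm_carrier H" unfolding z_def by (intro diff_mem zC y)
    then have 1: "cstar_pos (hm_inner H z z)" by (rule inner_pos)
    have zz: "hm_inner H z z = scaleR (1/X\<^sup>2) (star r * p * r) - scaleR (2/X) (star r * r) + q"
    proof -
      have "hm_inner H y x = star r" using star_inner[OF x y] by (simp add: r_def)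
      then have "hm_inner H z z = scaleR (1/X) (star r) * p * scaleR (1/X) r
          - scaleR (1/X) (star r) * r - (star r * scaleR (1/X) r - q)"
        unfolding z_def
        using x y zC
        by (simp add: inner_diff_left inner_diff_right diff_mem inner_act_left inner_act_right
            p_def q_def r_def mult.assoc left_diff_distrib scaleR_right_diff_distrib)
      also have "\<dots> = scaleR (1/X\<^sup>2) (star r * p * r)
          - (scaleR (1/X) (star r * r) + scaleR (1/X) (star r * r)) + q"
        by (simp add: power2_eq_square)
      also have "scaleR (1/X) (star r * r) + scaleR (1/X) (star r * r) = scaleR (2/X) (star r * r)"
        by (simp add: scaleR_left_distrib[symmetric])
      finally show ?thesis .
    qed
    \<comment> \<open>Through the root \<open>s\<close> of \<open>X - p\<close>, the element
      \<open>star r * (X - p) * r\<close> becomes a hermitian square and is therefore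
      positive.\<close>
    have "cstar_pos (scaleR X 1 - p)"
      using X by (intro cstar_pos_scaleR_one_diff inner_pos[OF x, folded p_def]) auto
    then obtain s where s: "s * s = scaleR X 1 - p" "cstar_pos s" using cstar_pos_sqrt by blast
    have "star (s * r) * (s * r) = star r * (s * s) * r"
      using cstar_pos_self_adjoint[OF s(2)] by (simp add: star_mult mult.assoc)
    also have "\<dots> = scaleR X (star r * r) - star r * p * r" by (simp add: s(1) algebra_simps)
    finally have "cstar_pos (scaleR X (star r * r) - star r * p * r)"
      using cstar_pos_star_mult_self[of "s * r"] by simp
    then have 2: "cstar_pos (scaleR (1/X\<^sup>2) (scaleR X (star r * r) - star r * p * r))"
      by (rule cstar_pos_scaleR) simp
    have 3: "scaleR (1/X\<^sup>2) (scaleR X (star r * r) - star r * p * r)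
        = scaleR (1/X) (star r * r) - scaleR (1/X\<^sup>2) (star r * p * r)"
      using \<open>X > 0\<close> by (simp add: scaleR_right_diff_distrib power2_eq_square)
    have 4: "scaleR (2/X) (star r * r) = scaleR (1/X) (star r * r) + scaleR (1/X) (star r * r)"
      by (simp add: scaleR_left_distrib[symmetric])
    have "cstar_pos (q - scaleR (1/X) (star r * r))"
      using cstar_pos_add[OF 1 2] unfolding zz 3 4 by (simp add: algebra_simps)
    moreover have "cstar_pos (scaleR (1/X) (star r * r))"
      using \<open>X > 0\<close> by (intro cstar_pos_scaleR cstar_pos_star_mult_self) auto
    ultimately have "norm (scaleR (1/X) (star r * r)) \<le> norm q"
      using cstar_pos_norm_mono by fastforce
    then show ?thesis using \<open>X > 0\<close> by (simp add: norm_star_mult_self field_simps)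
  qed
  \<comment> \<open>Dividing by \<open>norm q\<close> lets \<open>X\<close> tend to
    \<open>norm p\<close>; if \<open>q = 0\<close>, a single value of \<open>X\<close> already gives
    \<open>r = 0\<close>.\<close>
  have "(norm r)\<^sup>2 \<le> norm p * norm q"
  proof (cases "q = 0")
    case True
    then show ?thesis using *[of "norm p + 1"] by simp
  next
    case False
    have "(norm r)\<^sup>2 / norm q \<le> norm p"
    proof (rule dense_ge)
      fix X assume "norm p < X"
      from *[OF this] False show "(norm r)\<^sup>2 / norm q \<le> X" by (simp add: pos_divide_le_eq)
    qed
    then show ?thesis using False by (simp add: field_simps)
  qed
  then show ?thesis
    unfolding hm_norm_def p_def q_def r_def
    by (metis norm_ge_zero real_le_rsqrt real_sqrt_mult)
qed

section \<open>The seminorm of a module\<close>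

lemma norm_triangle:
  assumes x: "x \<in> hm_carrier H" and y: "y \<in> hm_carrier H"
  shows "hm_norm H (x + y) \<le> hm_norm H x + hm_norm H y"
proof (rule power2_le_imp_le)
  have "hm_inner H (x + y) (x + y)
      = hm_inner H x x + hm_inner H x y + (hm_inner H y x + hm_inner H y y)"
    using x y by (simp add: inner_add_left inner_add_right add_mem)
  then have "norm (hm_inner H (x + y) (x + y))
      \<le> norm (hm_inner H x x) + norm (hm_inner H x y) + (norm (hm_inner H y x) + norm (hm_inner H y y))"
    by (simp add: norm_triangle_mono)
  also have "\<dots> \<le> (hm_norm H x)\<^sup>2 + hm_norm H x * hm_norm H y
      + (hm_norm H y * hm_norm H x + (hm_norm H y)\<^sup>2)"
    using Cauchy_Schwarz[OF x y] Cauchy_Schwarz[OF y x]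
    by (intro add_mono) (simp_all add: hm_norm_power2)
  finally show "(hm_norm H (x + y))\<^sup>2 \<le> (hm_norm H x + hm_norm H y)\<^sup>2"
    by (simp add: hm_norm_power2[of H "x + y"] power2_sum)
qed simp

lemma norm_minus: "x \<in> hm_carrier H \<Longrightarrow> hm_norm H (- x) = hm_norm H x"
  by (simp add: hm_norm_def inner_minus_left inner_minus_right minus_mem)

lemma norm_minus_commute:
  "x \<in> hm_carrier H \<Longrightarrow> y \<in> hm_carrier H \<Longrightarrow> hm_norm H (x - y) = hm_norm H (y - x)"
  using norm_minus[of "x - y"] diff_mem by simp

lemma norm_triangle_diff:
  "x \<in> hm_carrier H \<Longrightarrow> y \<in> hm_carrier H \<Longrightarrow> hm_norm H (x - y) \<le> hm_norm H x + hm_norm H y"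
  using norm_triangle[of x "- y"] norm_minus[of y] minus_mem by simp

lemma norm_zero [simp]: "hm_norm H 0 = 0"
  by (simp add: hm_norm_def inner_zero_right)

lemma norm_act_scaleR:
  assumes "x \<in> hm_carrier H"
  shows "hm_norm H (hm_act H x (scaleR t 1)) = \<bar>t\<bar> * hm_norm H x"
  using assms
  by (simp add: hm_norm_def inner_act_left inner_act_right act_mem real_sqrt_mult)

lemma semi_hilbert_module_restrict:
  assumes "hm_submodule H M"
  shows "semi_hilbert_module (hm_restrict H M)"
proof -
  have "x \<in> M \<Longrightarrow> x \<in> hm_carrier H" for x using assms by (auto simp: hm_submodule_def)
  then show ?thesis
    using assms unfolding hm_submodule_def
    by unfold_locales
      (auto simp: act_minus_one act_add_left act_add_right act_act inner_add_right inner_act_right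
        star_inner inner_pos)
qed

end

section \<open>Bounded linear operators\<close>

definition hm_bounded_linear ::
  "('a::unital_cstar_algebra, 'h::ab_group_add) hilbert_module
    \<Rightarrow> ('a, 'k::ab_group_add) hilbert_module \<Rightarrow> ('h \<Rightarrow> 'k) \<Rightarrow> bool" where
  "hm_bounded_linear H K T \<longleftrightarrow> hm_linear H K T \<and> hm_bounded H K T"

lemma hm_bounded_linear_mem:
  "hm_bounded_linear H K T \<Longrightarrow> x \<in> hm_carrier H \<Longrightarrow> T x \<in> hm_carrier K"
  by (auto simp: hm_bounded_linear_def hm_linear_def)

lemma hm_bounded_linear_act:
  "hm_bounded_linear H K T \<Longrightarrow> x \<in> hm_carrier H \<Longrightarrow> T (hm_act H x a) = hm_act K (T x) a"
  by (auto simp: hm_bounded_linear_def hm_linear_def)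

lemma hm_bounded_linear_add:
  "hm_bounded_linear H K T \<Longrightarrow> x \<in> hm_carrier H \<Longrightarrow> y \<in> hm_carrier H \<Longrightarrow> T (x + y) = T x + T y"
  by (auto simp: hm_bounded_linear_def hm_linear_def)

lemma hm_bounded_linear_bound:
  assumes "hm_bounded_linear H K T"
  obtains B where "0 \<le> B" "\<And>x. x \<in> hm_carrier H \<Longrightarrow> hm_norm K (T x) \<le> B * hm_norm H x"
  using hm_bounded_nonneg assms unfolding hm_bounded_linear_def by blast

lemma hm_bounded_linearI:
  assumes "\<And>x. x \<in> hm_carrier H \<Longrightarrow> T x \<in> hm_carrier K"
    "\<And>x y. x \<in> hm_carrier H \<Longrightarrow> y \<in> hm_carrier H \<Longrightarrow> T (x + y) = T x + T y"
    "\<And>x a. x \<in> hm_carrier H \<Longrightarrow> T (hm_act H x a) = hm_act K (T x) a"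
    "\<And>x. x \<in> hm_carrier H \<Longrightarrow> hm_norm K (T x) \<le> B * hm_norm H x"
  shows "hm_bounded_linear H K T"
  unfolding hm_bounded_linear_def hm_linear_def hm_bounded_def using assms by blast

lemma hm_bounded_linear_restrict_domain:
  assumes "hm_bounded_linear H K T" "M \<subseteq> hm_carrier H"
  shows "hm_bounded_linear (hm_restrict H M) K T"
proof -
  obtain B where "\<And>x. x \<in> hm_carrier H \<Longrightarrow> hm_norm K (T x) \<le> B * hm_norm H x"
    using hm_bounded_linear_bound[OF assms(1)] by blast
  then show ?thesis
    using assms(2) by (intro hm_bounded_linearI[where B = B])
      (auto simp: subsetD[OF assms(2)] hm_bounded_linear_mem[OF assms(1)] hm_bounded_linear_add[OF assms(1)]
        hm_bounded_linear_act[OF assms(1)])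
qed

lemma hm_bounded_linear_restrict_codomain:
  "hm_bounded_linear H (hm_restrict K M) T \<longleftrightarrow> hm_bounded_linear H K T \<and> T ` hm_carrier H \<subseteq> M"
  if "M \<subseteq> hm_carrier K"
  using that unfolding hm_bounded_linear_def hm_linear_def hm_bounded_def by auto

lemma hm_bounded_linear_compose:
  assumes T: "hm_bounded_linear H K T" and S: "hm_bounded_linear K L S"
  shows "hm_bounded_linear H L (\<lambda>x. S (T x))"
proof -
  obtain B where B: "0 \<le> B" "\<And>x. x \<in> hm_carrier H \<Longrightarrow> hm_norm K (T x) \<le> B * hm_norm H x"
    using hm_bounded_linear_bound[OF T] by blast
  obtain A where A: "0 \<le> A" "\<And>x. x \<in> hm_carrier K \<Longrightarrow> hm_norm L (S x) \<le> A * hm_norm K x"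
    using hm_bounded_linear_bound[OF S] by blast
  show ?thesis
  proof (rule hm_bounded_linearI[where B = "A * B"])
    fix x assume x: "x \<in> hm_carrier H"
    show "hm_norm L (S (T x)) \<le> A * B * hm_norm H x"
      using A(2)[OF hm_bounded_linear_mem[OF T x]] mult_left_mono[OF B(2)[OF x] A(1)]
      by (simp add: mult.assoc)
  qed (simp_all add: hm_bounded_linear_mem[OF T] hm_bounded_linear_mem[OF S]
      hm_bounded_linear_add[OF T] hm_bounded_linear_add[OF S]
      hm_bounded_linear_act[OF T] hm_bounded_linear_act[OF S])
qed

lemma hm_adjointable_bounded_linear: "T \<in> hm_adjointable H K \<Longrightarrow> hm_bounded_linear H K T"
  by (auto simp: hm_adjointable_def hm_bounded_linear_def)

text \<open>The definition bounds the choice function \<open>inv_into\<close>; on the target carrier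
  it agrees with any explicit inverse, so bounding the latter suffices.\<close>

lemma hm_isomorphismI:
  assumes "hm_bounded_linear H K T" and S: "\<And>y. y \<in> hm_carrier K \<Longrightarrow> S y \<in> hm_carrier H"
    and ST: "\<And>x. x \<in> hm_carrier H \<Longrightarrow> S (T x) = x"
    and TS: "\<And>y. y \<in> hm_carrier K \<Longrightarrow> T (S y) = y"
    and "hm_bounded K H S"
  shows "hm_isomorphism H K T"
proof -
  have bij: "bij_betw T (hm_carrier H) (hm_carrier K)"
    using S ST TS hm_bounded_linear_mem[OF assms(1)] by (intro bij_betwI[where g = S]) auto
  have "inv_into (hm_carrier H) T y = S y" if "y \<in> hm_carrier K" for y
    using bij S TS that by (metis bij_betw_imp_inj_on inv_into_f_f)
  then have "hm_bounded K H (inv_into (hm_carrier H) T)"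
    using assms(5) by (simp add: hm_bounded_def)
  then show ?thesis using assms(1) bij by (simp add: hm_isomorphism_def hm_bounded_linear_def)
qed

lemma hm_isomorphism_inverse:
  assumes "hm_isomorphism H K T" "semi_hilbert_module H"
  obtains S where "hm_bounded_linear K H S"
    "\<And>x. x \<in> hm_carrier H \<Longrightarrow> S (T x) = x" "\<And>y. y \<in> hm_carrier K \<Longrightarrow> T (S y) = y"
proof
  interpret semi_hilbert_module H by fact
  let ?S = "inv_into (hm_carrier H) T"
  have bij: "bij_betw T (hm_carrier H) (hm_carrier K)" and "hm_bounded K H ?S"
    and T: "hm_bounded_linear H K T"
    using assms(1) by (auto simp: hm_isomorphism_def hm_bounded_linear_def)
  show ST: "?S (T x) = x" if "x \<in> hm_carrier H" for x
    using bij that by (simp add: bij_betw_inv_into_left)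
  show TS: "T (?S y) = y" if "y \<in> hm_carrier K" for y
    using bij that by (simp add: bij_betw_inv_into_right)
  have S: "?S y \<in> hm_carrier H" if "y \<in> hm_carrier K" for y
    using bij that by (metis bij_betw_def inv_into_into)
  have "?S (x + y) = ?S x + ?S y" if "x \<in> hm_carrier K" "y \<in> hm_carrier K" for x y
    using ST[of "?S x + ?S y"] hm_bounded_linear_add[OF T S[OF that(1)] S[OF that(2)]]
      S[OF that(1)] S[OF that(2)] TS that add_mem by simp
  moreover have "?S (hm_act K x a) = hm_act H (?S x) a" if "x \<in> hm_carrier K" for x a
    using ST[of "hm_act H (?S x) a"] hm_bounded_linear_act[OF T S[OF that]] S[OF that] TS that act_mem
    by simp
  ultimately show "hm_bounded_linear K H ?S"
    using S \<open>hm_bounded K H ?S\<close> by (auto simp: hm_bounded_linear_def hm_linear_def)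
qed

section \<open>Decompositions and closed submodules\<close>

lemma hm_decompositionD:
  assumes "hm_decomposition H M N"
  shows "hm_closed_submodule H M" "hm_closed_submodule H N" "M \<inter> N = {0}"
    "x \<in> hm_carrier H \<Longrightarrow> \<exists>m\<in>M. \<exists>n\<in>N. x = m + n"
proof -
  note d = assms[unfolded hm_decomposition_def]
  show "hm_closed_submodule H M" "hm_closed_submodule H N" "M \<inter> N = {0}"
    by (rule d[THEN conjunct1] d[THEN conjunct2, THEN conjunct1]
        d[THEN conjunct2, THEN conjunct2, THEN conjunct1])+
  show "\<exists>m\<in>M. \<exists>n\<in>N. x = m + n" if "x \<in> hm_carrier H"
    using that equalityD1[OF d[THEN conjunct2, THEN conjunct2, THEN conjunct2]] by blast
qed

lemma hm_decompositionI:
  assumes "hm_closed_submodule H M" "hm_closed_submodule H N"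
    "\<And>x. x \<in> M \<Longrightarrow> x \<in> N \<Longrightarrow> x = 0"
    "\<And>x. x \<in> hm_carrier H \<Longrightarrow> \<exists>m\<in>M. \<exists>n\<in>N. x = m + n"
    "\<And>x y. x \<in> hm_carrier H \<Longrightarrow> y \<in> hm_carrier H \<Longrightarrow> x + y \<in> hm_carrier H"
  shows "hm_decomposition H M N"
proof -
  have sub: "M \<subseteq> hm_carrier H" "N \<subseteq> hm_carrier H" and "0 \<in> M" "0 \<in> N"
    using assms(1,2) by (simp_all add: hm_closed_submodule_def hm_submodule_def)
  have "M \<inter> N = {0}" using \<open>0 \<in> M\<close> \<open>0 \<in> N\<close> assms(3) by blast
  moreover have "hm_carrier H = {m + n | m n. m \<in> M \<and> n \<in> N}" (is "_ = ?R")
  proof (intro equalityI subsetI)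
    show "x \<in> ?R" if "x \<in> hm_carrier H" for x using assms(4)[OF that] by blast
    show "x \<in> hm_carrier H" if x: "x \<in> ?R" for x
    proof -
      obtain m n where "x = m + n" "m \<in> M" "n \<in> N" using x by blast
      then show ?thesis using assms(5)[of m n] sub by auto
    qed
  qed
  ultimately show ?thesis unfolding hm_decomposition_def using assms(1,2) by (intro conjI)
qed

lemma hm_closed_submodule_Int:
  assumes "hm_closed_submodule H M" "hm_closed_submodule H N"
  shows "hm_closed_submodule H (M \<inter> N)"
  unfolding hm_closed_submodule_def
proof (intro conjI ballI impI)
  show "hm_submodule H (M \<inter> N)"
    using assms unfolding hm_closed_submodule_def hm_submodule_def by (simp add: le_infI1)
  fix x assume x: "x \<in> hm_carrier H" and lim: "\<forall>e>0. \<exists>y\<in>M \<inter> N. hm_norm H (x - y) < e"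
  from lim have "\<forall>e>0. \<exists>y\<in>M. hm_norm H (x - y) < e" by blast
  moreover from lim have "\<forall>e>0. \<exists>y\<in>N. hm_norm H (x - y) < e" by blast
  ultimately show "x \<in> M \<inter> N" using assms x unfolding hm_closed_submodule_def by simp
qed

context semi_hilbert_module
begin

section \<open>Sums, preimages and projections\<close>

lemma hm_bounded_linear_diff:
  assumes T: "hm_bounded_linear X H T" and S: "hm_bounded_linear X H S"
  shows "hm_bounded_linear X H (\<lambda>x. T x - S x)"
proof -
  obtain B where B: "\<And>x. x \<in> hm_carrier X \<Longrightarrow> hm_norm H (T x) \<le> B * hm_norm X x"
    using hm_bounded_linear_bound[OF T] by blast
  obtain A where A: "\<And>x. x \<in> hm_carrier X \<Longrightarrow> hm_norm H (S x) \<le> A * hm_norm X x"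
    using hm_bounded_linear_bound[OF S] by blast
  note mem = hm_bounded_linear_mem[OF T] hm_bounded_linear_mem[OF S]
  show ?thesis
  proof (rule hm_bounded_linearI[where B = "B + A"])
    fix x assume x: "x \<in> hm_carrier X"
    show "hm_norm H (T x - S x) \<le> (B + A) * hm_norm X x"
      using norm_triangle_diff[OF mem[OF x]] A[OF x] B[OF x] by (simp add: distrib_right)
  qed (simp_all add: mem diff_mem act_diff_left hm_bounded_linear_add[OF T] hm_bounded_linear_add[OF S]
      hm_bounded_linear_act[OF T] hm_bounded_linear_act[OF S])
qed

lemma hm_bounded_linear_plus:
  assumes T: "hm_bounded_linear X H T" and S: "hm_bounded_linear X H S"
  shows "hm_bounded_linear X H (\<lambda>x. T x + S x)"
proof -
  obtain B where B: "\<And>x. x \<in> hm_carrier X \<Longrightarrow> hm_norm H (T x) \<le> B * hm_norm X x"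
    using hm_bounded_linear_bound[OF T] by blast
  obtain A where A: "\<And>x. x \<in> hm_carrier X \<Longrightarrow> hm_norm H (S x) \<le> A * hm_norm X x"
    using hm_bounded_linear_bound[OF S] by blast
  note mem = hm_bounded_linear_mem[OF T] hm_bounded_linear_mem[OF S]
  show ?thesis
  proof (rule hm_bounded_linearI[where B = "B + A"])
    fix x assume x: "x \<in> hm_carrier X"
    show "hm_norm H (T x + S x) \<le> (B + A) * hm_norm X x"
      using norm_triangle[OF mem[OF x]] A[OF x] B[OF x] by (simp add: distrib_right)
  qed (simp_all add: mem add_mem act_add_left hm_bounded_linear_add[OF T] hm_bounded_linear_add[OF S]
      hm_bounded_linear_act[OF T] hm_bounded_linear_act[OF S])
qed

lemma hm_bounded_linear_id: "hm_bounded_linear H H (\<lambda>x. x)"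
  by (rule hm_bounded_linearI[where B = 1]) auto

lemma hm_bounded_linear_zero [simp]: "hm_bounded_linear H K T \<Longrightarrow> T 0 = 0"
  using hm_bounded_linear_add[of H K T 0 0] by simp

lemma hm_bounded_linear_minus_arg:
  "hm_bounded_linear H K T \<Longrightarrow> x \<in> hm_carrier H \<Longrightarrow> y \<in> hm_carrier H \<Longrightarrow> T (x - y) = T x - T y"
  using hm_bounded_linear_add[of H K T "x - y" y] diff_mem by simp

lemma hm_closed_submodule_preimage:
  assumes M: "hm_closed_submodule K M" and T: "hm_bounded_linear H K T"
  shows "hm_closed_submodule H {x \<in> hm_carrier H. T x \<in> M}"
  unfolding hm_closed_submodule_def
proof (intro conjI ballI impI)
  show "hm_submodule H {x \<in> hm_carrier H. T x \<in> M}"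
    using M by (auto simp: hm_closed_submodule_def hm_submodule_def add_mem act_mem
        hm_bounded_linear_zero[OF T] hm_bounded_linear_add[OF T] hm_bounded_linear_act[OF T])
next
  fix x assume x: "x \<in> hm_carrier H"
    and lim: "\<forall>e>0. \<exists>y\<in>{x \<in> hm_carrier H. T x \<in> M}. hm_norm H (x - y) < e"
  obtain B where B: "0 \<le> B" "\<And>x. x \<in> hm_carrier H \<Longrightarrow> hm_norm K (T x) \<le> B * hm_norm H x"
    using hm_bounded_linear_bound[OF T] by blast
  have "\<exists>z\<in>M. hm_norm K (T x - z) < e" if "e > 0" for e
  proof -
    \<comment> \<open>\<open>B + 1\<close> replaces \<open>B\<close>, which may be zero.\<close>
    have "e / (B + 1) > 0" using that B(1) by simp
    then obtain y where y: "y \<in> hm_carrier H" "T y \<in> M" "hm_norm H (x - y) < e / (B + 1)"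
      using lim by blast
    have "hm_norm K (T x - T y) \<le> B * hm_norm H (x - y)"
      using B(2)[of "x - y"] x y(1) by (simp add: diff_mem hm_bounded_linear_minus_arg[OF T])
    also have "\<dots> \<le> (B + 1) * hm_norm H (x - y)" by (simp add: mult_right_mono)
    also have "\<dots> < e" using y(3) B(1) by (simp add: field_simps)
    finally show ?thesis using y(2) by blast
  qed
  then show "x \<in> {x \<in> hm_carrier H. T x \<in> M}"
    using M x hm_bounded_linear_mem[OF T x] by (auto simp: hm_closed_submodule_def)
qed

text \<open>The component in \<open>N\<close> is unique, which gives linearity by comparing two
  candidates. The inner square of \<open>x\<close> is the sum of those of \<open>P x\<close> and
  \<open>x - P x\<close>, so norm monotonicity makes \<open>P\<close> a contraction. The last clause
  is the form of self-adjointness from which the adjoint of \<open>C\<close> is computed.\<close>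

lemma orthogonal_projection:
  assumes dec: "hm_decomposition H (hm_perp H N) N"
  obtains P where "hm_bounded_linear H (hm_restrict H N) P"
    "\<And>x. x \<in> hm_carrier H \<Longrightarrow> x - P x \<in> hm_perp H N"
    "\<And>x. x \<in> N \<Longrightarrow> P x = x" "\<And>x. x \<in> hm_perp H N \<Longrightarrow> P x = 0"
    "\<And>x y. x \<in> hm_carrier H \<Longrightarrow> y \<in> N \<Longrightarrow> hm_inner H (P x) y = hm_inner H x y"
proof -
  have sub: "hm_submodule H N" "hm_submodule H (hm_perp H N)" and int: "hm_perp H N \<inter> N = {0}"
    using hm_decompositionD(1-3)[OF dec] by (simp_all add: hm_closed_submodule_def)
  have N: "x \<in> hm_carrier H" if "x \<in> N" for x
    using sub that unfolding hm_submodule_def by blast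
  interpret N: semi_hilbert_module "hm_restrict H N" by (rule semi_hilbert_module_restrict[OF sub(1)])
  interpret O: semi_hilbert_module "hm_restrict H (hm_perp H N)"
    by (rule semi_hilbert_module_restrict[OF sub(2)])
  have perp: "x \<in> hm_carrier H" if "x \<in> hm_perp H N" for x using that by (simp add: hm_perp_def)
  have unique: "n = n'" if "n \<in> N" "n' \<in> N" "x - n \<in> hm_perp H N" "x - n' \<in> hm_perp H N" for x n n'
  proof -
    have "n - n' \<in> hm_perp H N" using O.diff_mem[of "x - n'" "x - n"] that by simp
    moreover have "n - n' \<in> N" using N.diff_mem[of n n'] that by simp
    ultimately have "n - n' \<in> hm_perp H N \<inter> N" by (rule IntI)
    then show ?thesis unfolding int by simp
  qed
  have "\<exists>n. n \<in> N \<and> x - n \<in> hm_perp H N" if x: "x \<in> hm_carrier H" for x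
  proof -
    obtain m n where "x = m + n" "m \<in> hm_perp H N" "n \<in> N" using hm_decompositionD(4)[OF dec x] by blast
    then show ?thesis by (intro exI[of _ n]) simp
  qed
  then obtain P where P: "\<And>x. x \<in> hm_carrier H \<Longrightarrow> P x \<in> N"
    "\<And>x. x \<in> hm_carrier H \<Longrightarrow> x - P x \<in> hm_perp H N" by metis
  have inner: "hm_inner H (x - P x) y = 0" if "x \<in> hm_carrier H" "y \<in> N" for x y
    using P(2)[OF that(1)] that(2) by (simp add: hm_perp_def)
  have bound: "hm_norm H (P x) \<le> 1 * hm_norm H x" if x: "x \<in> hm_carrier H" for x
  proof -
    have px: "P x \<in> hm_carrier H" using P(1) x N by blast
    have d: "x - P x \<in> hm_carrier H" using P(2) x perp by blast
    have "hm_inner H (P x) (x - P x) = 0"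
      using arg_cong[OF inner[OF x P(1)[OF x]], of star] star_inner[OF d px] by simp
    then have "hm_inner H x x = hm_inner H (P x) (P x) + hm_inner H (x - P x) (x - P x)"
      using inner[OF x P(1)[OF x]] inner_add_left[of "P x + (x - P x)" "P x" "x - P x"]
        inner_add_right[of "P x" "P x" "x - P x"] inner_add_right[of "x - P x" "P x" "x - P x"] px d x
      by simp
    then have "norm (hm_inner H (P x) (P x)) \<le> norm (hm_inner H x x)"
      using cstar_pos_norm_mono[OF inner_pos[OF px] inner_pos[OF d]] by simp
    then show ?thesis by (simp add: hm_norm_def)
  qed
  show ?thesis
  proof (rule that[of P])
    show "hm_bounded_linear H (hm_restrict H N) P"
    proof (rule hm_bounded_linearI[where B = 1])
      show "P (x + y) = P x + P y" if xy: "x \<in> hm_carrier H" "y \<in> hm_carrier H" for x y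
      proof (rule unique[of _ _ "x + y"])
        have "(x - P x) + (y - P y) \<in> hm_perp H N" using O.add_mem[of "x - P x" "y - P y"] P(2)[OF xy(1)] P(2)[OF xy(2)] by simp
        then show "x + y - (P x + P y) \<in> hm_perp H N" by (simp add: algebra_simps)
        show "P x + P y \<in> N" using N.add_mem[of "P x" "P y"] P(1)[OF xy(1)] P(1)[OF xy(2)] by simp
      qed (use P(1,2)[OF add_mem[OF xy]] in simp_all)
      show "P (hm_act H x a) = hm_act (hm_restrict H N) (P x) a" if x: "x \<in> hm_carrier H" for x a
      proof (rule unique[of _ _ "hm_act H x a"])
        have "hm_act H (x - P x) a \<in> hm_perp H N" using O.act_mem[of "x - P x" a] P(2)[OF x] by simp
        then show "hm_act H x a - hm_act (hm_restrict H N) (P x) a \<in> hm_perp H N"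
          using act_diff_left[OF x N[OF P(1)[OF x]], of a] by simp
        show "hm_act (hm_restrict H N) (P x) a \<in> N" using N.act_mem[of "P x" a] P(1)[OF x] by simp
      qed (use P(1,2)[OF act_mem[OF x]] in simp_all)
    qed (use P(1) bound in auto)
    show "P x = x" if "x \<in> N" for x
      using P(1,2)[OF N[OF that]] that O.zero_mem by (intro unique[of "P x" x x]) simp_all
    show "P x = 0" if "x \<in> hm_perp H N" for x
      using P(1,2)[OF perp[OF that]] that N.zero_mem by (intro unique[of "P x" 0 x]) simp_all
    show "hm_inner H (P x) y = hm_inner H x y" if xy: "x \<in> hm_carrier H" "y \<in> N" for x y
      using inner[OF xy] inner_diff_left[OF N[OF xy(2)] xy(1) N[OF P(1)[OF xy(1)]]] by simp
  qed (use P(2) in blast)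
qed

end

section \<open>Complete Hilbert modules\<close>

text \<open>Completeness is spelled out for sequences because the module norm is not a norm on the
  ambient type, which is only assumed to be an abelian group.\<close>

locale complete_hilbert_module = semi_hilbert_module +
  assumes inner_self_eq_0: "x \<in> hm_carrier H \<Longrightarrow> hm_inner H x x = 0 \<Longrightarrow> x = 0"
    and complete: "\<And>X. (\<And>n::nat. X n \<in> hm_carrier H) \<Longrightarrow>
      (\<And>e. e > 0 \<Longrightarrow> \<exists>N. \<forall>m\<ge>N. \<forall>n\<ge>N. hm_norm H (X m - X n) < e) \<Longrightarrow>
      \<exists>x\<in>hm_carrier H. (\<lambda>n. hm_norm H (X n - x)) \<longlonglongrightarrow> 0"
begin

lemma norm_eq_0: "x \<in> hm_carrier H \<Longrightarrow> hm_norm H x = 0 \<Longrightarrow> x = 0"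
  using inner_self_eq_0 by (simp add: hm_norm_def)

lemma complete_hilbert_module_restrict:
  assumes "hm_closed_submodule H M"
  shows "complete_hilbert_module (hm_restrict H M)"
proof -
  have sub: "hm_submodule H M" and
    closed: "\<And>x. x \<in> hm_carrier H \<Longrightarrow> \<forall>e>0. \<exists>y\<in>M. hm_norm H (x - y) < e \<Longrightarrow> x \<in> M"
    using assms by (simp_all add: hm_closed_submodule_def)
  have M: "M \<subseteq> hm_carrier H" using sub by (simp add: hm_submodule_def)
  interpret M: semi_hilbert_module "hm_restrict H M" by (rule semi_hilbert_module_restrict[OF sub])
  show ?thesis
  proof unfold_locales
    show "x = 0" if "x \<in> hm_carrier (hm_restrict H M)" "hm_inner (hm_restrict H M) x x = 0" for x
      using that M inner_self_eq_0[of x] by auto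
  next
    fix X :: "nat \<Rightarrow> 'b"
    assume X: "\<And>n. X n \<in> hm_carrier (hm_restrict H M)"
      and C: "\<And>e. e > 0 \<Longrightarrow> \<exists>N. \<forall>m\<ge>N. \<forall>n\<ge>N. hm_norm (hm_restrict H M) (X m - X n) < e"
    have XH: "X n \<in> hm_carrier H" for n using X[of n] M by auto
    obtain x where x: "x \<in> hm_carrier H" "(\<lambda>n. hm_norm H (X n - x)) \<longlonglongrightarrow> 0"
      using complete[OF XH C[unfolded hm_restrict_simps]] by blast
    have "x \<in> M"
    proof (rule closed[OF x(1)], intro allI impI)
      fix e :: real assume "e > 0"
      from order_tendstoD(2)[OF x(2) this] obtain n where "hm_norm H (X n - x) < e"
        by (auto simp: eventually_sequentially)
      then show "\<exists>y\<in>M. hm_norm H (x - y) < e"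
        using X[of n] norm_minus_commute[OF x(1) XH[of n]] by (intro bexI[of _ "X n"]) simp_all
    qed
    then show "\<exists>x\<in>hm_carrier (hm_restrict H M).
        (\<lambda>n. hm_norm (hm_restrict H M) (X n - x)) \<longlonglongrightarrow> 0"
      using x(2) by auto
  qed
qed

lemma hm_closed_submodule_zero: "hm_closed_submodule H {0}"
  unfolding hm_closed_submodule_def
proof (intro conjI ballI impI)
  show "hm_submodule H {0}" by (simp add: hm_submodule_def)
  fix x assume x: "x \<in> hm_carrier H" and "\<forall>e>0. \<exists>y\<in>{0}. hm_norm H (x - y) < e"
  then have lt: "hm_norm H x < e" if "e > 0" for e using that by simp
  then have "hm_norm H x = 0" using lt[of "hm_norm H x"] hm_norm_nonneg[of H x] by linarith
  then show "x \<in> {0}" using norm_eq_0[OF x] by simp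
qed

lemma hm_closed_submodule_kernel:
  assumes "semi_hilbert_module X" "hm_bounded_linear X H T"
  shows "hm_closed_submodule X {x \<in> hm_carrier X. T x = 0}"
  using semi_hilbert_module.hm_closed_submodule_preimage[OF assms(1) hm_closed_submodule_zero assms(2)]
  by simp

lemma geometric_convergent:
  assumes X: "\<And>n. X n \<in> hm_carrier H" and K: "\<And>n. hm_norm H (X (Suc n) - X n) \<le> K / 2 ^ n"
  shows "\<exists>x\<in>hm_carrier H. (\<lambda>n. hm_norm H (X n - x)) \<longlonglongrightarrow> 0"
proof (rule complete[OF X])
  have "0 \<le> K" using order_trans[OF hm_norm_nonneg K[of 0]] by simp
  \<comment> \<open>The right side is the geometric sum of \<open>K / 2 ^ (n + i)\<close> over
    \<open>i < k\<close>; the closed form carries the induction.\<close>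
  have *: "hm_norm H (X (n + k) - X n) \<le> 2 * K / 2 ^ n * (1 - 1 / 2 ^ k)" for n k
  proof (induction k)
    case (Suc k)
    have "hm_norm H (X (n + Suc k) - X n)
        = hm_norm H ((X (Suc (n + k)) - X (n + k)) + (X (n + k) - X n))" by simp
    also have "\<dots> \<le> K / 2 ^ (n + k) + 2 * K / 2 ^ n * (1 - 1 / 2 ^ k)"
      using K[of "n + k"] Suc norm_triangle[OF diff_mem[OF X X] diff_mem[OF X X]]
      by (meson add_mono order_trans)
    also have "\<dots> = 2 * K / 2 ^ n * (1 - 1 / 2 ^ Suc k)"
      by (simp add: power_add field_simps)
    finally show ?case .
  qed simp
  have **: "hm_norm H (X m - X n) \<le> 2 * K / 2 ^ n" if mn: "n \<le> m" for m n
  proof -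
    have "2 * K / 2 ^ n * (1 - 1 / 2 ^ (m - n)) \<le> 2 * K / 2 ^ n * 1"
      using \<open>0 \<le> K\<close> by (intro mult_left_mono) simp_all
    then show ?thesis using *[of n "m - n"] mn by simp
  qed
  fix e :: real assume "e > 0"
  have "(\<lambda>n. 4 * K * (1/2) ^ n) \<longlonglongrightarrow> 4 * K * 0"
    by (intro tendsto_mult_left LIMSEQ_power_zero) simp
  then have "eventually (\<lambda>n. 4 * K * (1/2) ^ n < e) sequentially"
    using \<open>e > 0\<close> by (intro order_tendstoD(2)) simp_all
  then obtain N where N: "4 * K * (1/2) ^ N < e"
    by (auto simp: eventually_sequentially)
  have "hm_norm H (X m - X n) < e" if mn: "N \<le> m" "N \<le> n" for m n
  proof -
    have "hm_norm H (X m - X n) = hm_norm H ((X m - X N) - (X n - X N))" by simp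
    also have "\<dots> \<le> hm_norm H (X m - X N) + hm_norm H (X n - X N)"
      by (intro norm_triangle_diff diff_mem X)
    also have "\<dots> \<le> 2 * K / 2 ^ N + 2 * K / 2 ^ N" by (intro add_mono ** mn)
    also have "\<dots> = 4 * K * (1/2) ^ N" by (simp add: power_one_over field_simps)
    also note N
    finally show ?thesis .
  qed
  then show "\<exists>N. \<forall>m\<ge>N. \<forall>n\<ge>N. hm_norm H (X m - X n) < e" by blast
qed

text \<open>Solves \<open>A x = y - B x\<close> by iteration. The section \<open>G\<close> of
  \<open>A\<close> is chosen pointwise; the lower bound on \<open>A\<close> controls differences of
  iterates, and with \<open>B\<close> at most half as large each increment is at most half of the
  previous one.\<close>

lemma surjective_perturbation:
  assumes A: "hm_bounded_linear H H A" and B: "hm_bounded_linear H H B" and "d > 0"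
    and Ad: "\<And>x. x \<in> hm_carrier H \<Longrightarrow> d * hm_norm H x \<le> hm_norm H (A x)"
    and Bd: "\<And>x. x \<in> hm_carrier H \<Longrightarrow> hm_norm H (B x) \<le> d / 2 * hm_norm H x"
    and surj: "\<And>y. y \<in> hm_carrier H \<Longrightarrow> \<exists>x\<in>hm_carrier H. A x = y"
    and y: "y \<in> hm_carrier H"
  shows "\<exists>x\<in>hm_carrier H. A x + B x = y"
proof -
  obtain G where G: "\<And>y. y \<in> hm_carrier H \<Longrightarrow> G y \<in> hm_carrier H"
    "\<And>y. y \<in> hm_carrier H \<Longrightarrow> A (G y) = y" using surj by metis
  define X where "X = rec_nat 0 (\<lambda>_ x. G (y - B x))"
  have X0: "X 0 = 0" and XS: "X (Suc n) = G (y - B (X n))" for n by (simp_all add: X_def)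
  note BH = hm_bounded_linear_mem[OF B] and AH = hm_bounded_linear_mem[OF A]
  have XH: "X n \<in> hm_carrier H" for n
  proof (induction n)
    case (Suc n)
    then show ?case unfolding XS by (intro G(1) diff_mem y BH)
  qed (simp add: X0)
  have AX: "A (X (Suc n)) = y - B (X n)" for n
    unfolding XS by (intro G(2) diff_mem y BH XH)
  have step: "hm_norm H (X (Suc (Suc n)) - X (Suc n)) \<le> hm_norm H (X (Suc n) - X n) / 2" for n
  proof -
    have "d * hm_norm H (X (Suc (Suc n)) - X (Suc n)) \<le> hm_norm H (A (X (Suc (Suc n)) - X (Suc n)))"
      by (intro Ad diff_mem XH)
    also have "A (X (Suc (Suc n)) - X (Suc n)) = B (X n - X (Suc n))"
      unfolding hm_bounded_linear_minus_arg[OF A XH XH] hm_bounded_linear_minus_arg[OF B XH XH] AX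
      by simp
    also have "hm_norm H \<dots> \<le> d / 2 * hm_norm H (X n - X (Suc n))" by (intro Bd diff_mem XH)
    also have "hm_norm H (X n - X (Suc n)) = hm_norm H (X (Suc n) - X n)"
      by (rule norm_minus_commute[OF XH XH])
    finally show ?thesis using \<open>d > 0\<close> by simp
  qed
  have "hm_norm H (X (Suc n) - X n) \<le> hm_norm H (X 1) / 2 ^ n" for n
  proof (induction n)
    case (Suc n)
    have "hm_norm H (X (Suc n) - X n) / 2 \<le> hm_norm H (X 1) / 2 ^ n / 2"
      using Suc by (rule divide_right_mono) simp
    then show ?case using step[of n] by (simp add: mult.commute)
  qed (simp add: X0)
  then obtain z where z: "z \<in> hm_carrier H" "(\<lambda>n. hm_norm H (X n - z)) \<longlonglongrightarrow> 0"
    using geometric_convergent[of X, OF XH, of "hm_norm H (X 1)"] by blast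
  obtain M where M: "\<And>x. x \<in> hm_carrier H \<Longrightarrow> hm_norm H (A x) \<le> M * hm_norm H x"
    using hm_bounded_linear_bound[OF A] by blast
  have wH: "y - (A z + B z) \<in> hm_carrier H" by (intro diff_mem add_mem y AH BH z(1))
  \<comment> \<open>The residual at the limit is independent of \<open>n\<close> yet bounded by a
    sequence tending to 0, because \<open>A\<close> applied to one iterate plus \<open>B\<close>
    applied to its predecessor is exactly \<open>y\<close>.\<close>
  have le: "hm_norm H (y - (A z + B z))
      \<le> M * hm_norm H (X (Suc n) - z) + d / 2 * hm_norm H (X n - z)" for n
  proof -
    have "y - (A z + B z) = A (X (Suc n) - z) + B (X n - z)"
      unfolding hm_bounded_linear_minus_arg[OF A XH z(1)] hm_bounded_linear_minus_arg[OF B XH z(1)] AX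
      by simp
    also have "hm_norm H \<dots> \<le> hm_norm H (A (X (Suc n) - z)) + hm_norm H (B (X n - z))"
      by (intro norm_triangle AH BH diff_mem XH z(1))
    also have "\<dots> \<le> M * hm_norm H (X (Suc n) - z) + d / 2 * hm_norm H (X n - z)"
      by (intro add_mono M Bd diff_mem XH z(1))
    finally show ?thesis .
  qed
  have "(\<lambda>n. M * hm_norm H (X (Suc n) - z) + d / 2 * hm_norm H (X n - z)) \<longlonglongrightarrow> M * 0 + d / 2 * 0"
    by (intro tendsto_add tendsto_mult_left z(2) LIMSEQ_Suc[OF z(2)])
  then have "hm_norm H (y - (A z + B z)) \<le> M * 0 + d / 2 * 0"
    by (rule LIMSEQ_le_const) (use le in blast)
  then have "hm_norm H (y - (A z + B z)) = 0" using hm_norm_nonneg[of H "y - (A z + B z)"] by simp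
  then show ?thesis using norm_eq_0[OF wH] z(1) by auto
qed

lemma hm_bounded_linear_scale: "hm_bounded_linear H H (\<lambda>x. hm_act H x (scaleR t 1))"
  by (rule hm_bounded_linearI[where B = "\<bar>t\<bar>"])
    (simp_all add: act_mem act_add_left act_act norm_act_scaleR)

text \<open>
  If \<open>\<iota>\<close> is bounded below, then all operators \<open>\<iota>* \<iota> + t\<close> with \<open>t \<ge> 0\<close> are bounded below by the
  same constant, so that surjectivity propagates from large \<open>t\<close> down to \<open>t = 0\<close>.
\<close>

lemma adjointable_left_inverse:
  assumes K: "semi_hilbert_module K" and i: "\<iota> \<in> hm_adjointable H K" and "c > 0"
    and below: "\<And>x. x \<in> hm_carrier H \<Longrightarrow> c * hm_norm H x \<le> hm_norm K (\<iota> x)"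
  obtains L where "hm_bounded_linear K H L" "\<And>x. x \<in> hm_carrier H \<Longrightarrow> L (\<iota> x) = x"
proof -
  interpret K: semi_hilbert_module K by fact
  note bl = hm_adjointable_bounded_linear[OF i]
  note iK = hm_bounded_linear_mem[OF bl]
  obtain S where SH: "\<And>y. y \<in> hm_carrier K \<Longrightarrow> S y \<in> hm_carrier H"
    and adj: "\<And>x y. x \<in> hm_carrier H \<Longrightarrow> y \<in> hm_carrier K \<Longrightarrow> hm_inner K (\<iota> x) y = hm_inner H x (S y)"
    using i unfolding hm_adjointable_def by blast
  obtain B where B: "0 \<le> B" "\<And>x. x \<in> hm_carrier H \<Longrightarrow> hm_norm K (\<iota> x) \<le> B * hm_norm H x"
    using hm_bounded_linear_bound[OF bl] by blast
  have eqI: "u = v" if u: "u \<in> hm_carrier H" and v: "v \<in> hm_carrier H"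
    and eq: "\<And>x. x \<in> hm_carrier H \<Longrightarrow> hm_inner H x u = hm_inner H x v" for u v
  proof -
    have "hm_inner H (u - v) (u - v) = 0"
      using inner_diff_right[OF diff_mem[OF u v] u v] eq[OF diff_mem[OF u v]] by simp
    then have "u - v = 0" by (rule inner_self_eq_0[OF diff_mem[OF u v]])
    then show ?thesis by simp
  qed
  \<comment> \<open>An adjoint is given merely as a function. Nondegeneracy of the inner product
    makes it linear; Cauchy-Schwarz applied to \<open>\<iota> (S x)\<close> and \<open>x\<close>
    bounds it by the constant of \<open>\<iota>\<close>.\<close>
  have S: "hm_bounded_linear K H S"
  proof (rule hm_bounded_linearI[where B = B])
    show "S x \<in> hm_carrier H" if "x \<in> hm_carrier K" for x by (rule SH[OF that])
    show "S (x + y) = S x + S y" if x: "x \<in> hm_carrier K" and y: "y \<in> hm_carrier K" for x y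
    proof (rule eqI)
      fix u assume u: "u \<in> hm_carrier H"
      show "hm_inner H u (S (x + y)) = hm_inner H u (S x + S y)"
        using K.inner_add_right[OF iK[OF u] x y] inner_add_right[OF u SH[OF x] SH[OF y]]
          adj[OF u x] adj[OF u y] adj[OF u K.add_mem[OF x y]] by simp
    qed (intro SH add_mem K.add_mem x y)+
    show "S (hm_act K x a) = hm_act H (S x) a" if x: "x \<in> hm_carrier K" for x a
    proof (rule eqI)
      fix u assume u: "u \<in> hm_carrier H"
      show "hm_inner H u (S (hm_act K x a)) = hm_inner H u (hm_act H (S x) a)"
        using K.inner_act_right[OF iK[OF u] x, of a] inner_act_right[OF u SH[OF x], of a]
          adj[OF u x] adj[OF u K.act_mem[OF x]] by simp
    qed (intro SH act_mem K.act_mem x)+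
    show "hm_norm H (S x) \<le> B * hm_norm K x" if x: "x \<in> hm_carrier K" for x
    proof (cases "hm_norm H (S x) = 0")
      case True
      then show ?thesis using B(1) by simp
    next
      case False
      have "hm_norm H (S x) * hm_norm H (S x) = norm (hm_inner K (\<iota> (S x)) x)"
        using hm_norm_power2[of H "S x"] adj[OF SH[OF x] x] by (simp add: power2_eq_square)
      also have "\<dots> \<le> hm_norm K (\<iota> (S x)) * hm_norm K x" by (intro K.Cauchy_Schwarz iK SH x)
      also have "\<dots> \<le> B * hm_norm H (S x) * hm_norm K x"
        by (intro mult_right_mono B(2) SH x hm_norm_nonneg)
      finally have "hm_norm H (S x) * hm_norm H (S x) \<le> hm_norm H (S x) * (B * hm_norm K x)"
        by (simp add: mult_ac)
      moreover have "0 < hm_norm H (S x)" using False hm_norm_nonneg[of H "S x"] by linarith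
      ultimately show ?thesis by (simp only: mult_le_cancel_left_pos)
    qed
  qed
  define R where "R = (\<lambda>x. S (\<iota> x))"
  define Q where "Q = (\<lambda>t x. R x + hm_act H x (scaleR t 1))"
  have R: "hm_bounded_linear H H R" unfolding R_def by (rule hm_bounded_linear_compose[OF bl S])
  note RH = hm_bounded_linear_mem[OF R]
  have Q: "hm_bounded_linear H H (Q t)" for t
    unfolding Q_def by (rule hm_bounded_linear_plus[OF R hm_bounded_linear_scale])
  \<comment> \<open>The inner product of \<open>x\<close> with \<open>Q t x\<close> is that of
    \<open>\<iota> x\<close> with itself plus a positive term. Adding the latter cannot decrease the
    norm, hence a bound uniform in \<open>t\<close>.\<close>
  have Qbelow: "c\<^sup>2 * hm_norm H x \<le> hm_norm H (Q t x)" if x: "x \<in> hm_carrier H" and t: "0 \<le> t" for t x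
  proof (cases "hm_norm H x = 0")
    case False
    have "c\<^sup>2 * hm_norm H x * hm_norm H x = (c * hm_norm H x)\<^sup>2" by (simp add: power2_eq_square)
    also have "\<dots> \<le> (hm_norm K (\<iota> x))\<^sup>2"
      using below[OF x] \<open>c > 0\<close> by (intro power_mono) simp_all
    also have "\<dots> = norm (hm_inner K (\<iota> x) (\<iota> x))" by (rule hm_norm_power2)
    also have "\<dots> \<le> norm (hm_inner K (\<iota> x) (\<iota> x) + scaleR t (hm_inner H x x))"
      by (intro cstar_pos_norm_mono cstar_pos_scaleR K.inner_pos inner_pos iK x t)
    also have "hm_inner K (\<iota> x) (\<iota> x) + scaleR t (hm_inner H x x) = hm_inner H x (Q t x)"
      unfolding Q_def R_def
      using inner_add_right[OF x SH[OF iK[OF x]] act_mem[OF x, of "scaleR t 1"]]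
        inner_act_right[OF x x, of "scaleR t 1"] adj[OF x iK[OF x]] by simp
    also have "norm \<dots> \<le> hm_norm H x * hm_norm H (Q t x)"
      by (intro Cauchy_Schwarz x hm_bounded_linear_mem[OF Q])
    finally have "hm_norm H x * (c\<^sup>2 * hm_norm H x) \<le> hm_norm H x * hm_norm H (Q t x)"
      by (simp add: mult_ac)
    moreover have "0 < hm_norm H x" using False hm_norm_nonneg[of H x] by linarith
    ultimately show ?thesis by (simp only: mult_le_cancel_left_pos)
  qed simp
  define surj where "surj t \<longleftrightarrow> (\<forall>y\<in>hm_carrier H. \<exists>x\<in>hm_carrier H. Q t x = y)" for t
  have "c\<^sup>2 > 0" using \<open>c > 0\<close> by simp
  obtain M where M: "0 \<le> M" "\<And>x. x \<in> hm_carrier H \<Longrightarrow> hm_norm H (R x) \<le> M * hm_norm H x"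
    using hm_bounded_linear_bound[OF R] by blast
  \<comment> \<open>The parameter moves in steps of \<open>c\<^sup>2 / 2\<close>, half the common
    lower bound. The number of steps makes \<open>R\<close> at most half of the scalar
    \<open>t\<close> at the start, and the added 1 keeps \<open>t\<close> positive.\<close>
  obtain n where n: "2 * M + 1 \<le> real n * (c\<^sup>2 / 2)"
    using reals_Archimedean3[of "c\<^sup>2 / 2"] \<open>c\<^sup>2 > 0\<close> by (meson half_gt_zero less_imp_le)
  define t where "t = real n * (c\<^sup>2 / 2)"
  have t: "t > 0" "M \<le> t / 2" using n M(1) by (simp_all add: t_def)
  have "surj t"
    unfolding surj_def
  proof
    fix y assume y: "y \<in> hm_carrier H"
    have "\<exists>x\<in>hm_carrier H. hm_act H x (scaleR t 1) + R x = y"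
    proof (rule surjective_perturbation[OF hm_bounded_linear_scale R t(1) _ _ _ y])
      show "t * hm_norm H x \<le> hm_norm H (hm_act H x (scaleR t 1))" if "x \<in> hm_carrier H" for x
        using norm_act_scaleR[OF that, of t] t(1) by simp
      show "hm_norm H (R x) \<le> t / 2 * hm_norm H x" if "x \<in> hm_carrier H" for x
        using M(2)[OF that] mult_right_mono[OF t(2) hm_norm_nonneg[of H x]] by linarith
      show "\<exists>x\<in>hm_carrier H. hm_act H x (scaleR t 1) = y" if y: "y \<in> hm_carrier H" for y
        using act_act[OF y, of "scaleR (1/t) 1" "scaleR t 1"] act_one[OF y] t(1) act_mem[OF y]
        by (intro bexI[of _ "hm_act H y (scaleR (1/t) 1)"]) simp_all
    qed
    then show "\<exists>x\<in>hm_carrier H. Q t x = y" by (simp add: Q_def add.commute)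
  qed
  \<comment> \<open>Descending induction: each step treats the decrease of the parameter as a small
    perturbation of the operator already known to be surjective.\<close>
  have "surj (real 0 * (c\<^sup>2 / 2))"
    using le0[of n]
  proof (induction rule: inc_induct)
    case base
    show ?case using \<open>surj t\<close> by (simp add: t_def)
  next
    case (step k)
    show ?case
      unfolding surj_def
    proof
      fix y assume y: "y \<in> hm_carrier H"
      have "\<exists>x\<in>hm_carrier H. Q (real (Suc k) * (c\<^sup>2 / 2)) x + hm_act H x (scaleR (- (c\<^sup>2 / 2)) 1) = y"
      proof (rule surjective_perturbation[OF Q hm_bounded_linear_scale \<open>c\<^sup>2 > 0\<close> _ _ _ y])
        show "c\<^sup>2 * hm_norm H x \<le> hm_norm H (Q (real (Suc k) * (c\<^sup>2 / 2)) x)"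
          if "x \<in> hm_carrier H" for x by (rule Qbelow[OF that]) simp
        show "hm_norm H (hm_act H x (scaleR (- (c\<^sup>2 / 2)) 1)) \<le> c\<^sup>2 / 2 * hm_norm H x"
          if "x \<in> hm_carrier H" for x using norm_act_scaleR[OF that, of "- (c\<^sup>2 / 2)"] by simp
        show "\<exists>x\<in>hm_carrier H. Q (real (Suc k) * (c\<^sup>2 / 2)) x = y" if "y \<in> hm_carrier H" for y
          using step.IH that by (simp add: surj_def)
      qed
      then obtain x where x: "x \<in> hm_carrier H"
        "Q (real (Suc k) * (c\<^sup>2 / 2)) x + hm_act H x (scaleR (- (c\<^sup>2 / 2)) 1) = y" by blast
      have "real (Suc k) * (c\<^sup>2 / 2) + - (c\<^sup>2 / 2) = real k * (c\<^sup>2 / 2)"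
        by (simp add: algebra_simps)
      then have "hm_act H x (scaleR (real k * (c\<^sup>2 / 2)) 1)
          = hm_act H x (scaleR (real (Suc k) * (c\<^sup>2 / 2)) 1) + hm_act H x (scaleR (- (c\<^sup>2 / 2)) 1)"
        using act_add_right[OF x(1), of "scaleR (real (Suc k) * (c\<^sup>2 / 2)) 1" "scaleR (- (c\<^sup>2 / 2)) 1"]
        by (metis scaleR_left_distrib)
      then have "Q (real k * (c\<^sup>2 / 2)) x = y" using x(2) by (simp add: Q_def add.assoc)
      then show "\<exists>x\<in>hm_carrier H. Q (real k * (c\<^sup>2 / 2)) x = y" using x(1) by blast
    qed
  qed
  moreover have Q0: "Q 0 x = R x" if "x \<in> hm_carrier H" for x
    using act_zero_right[OF that] by (simp add: Q_def)
  ultimately have Rsurj: "\<exists>x\<in>hm_carrier H. R x = y" if "y \<in> hm_carrier H" for y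
    using that by (auto simp: surj_def)
  have Rbelow: "c\<^sup>2 * hm_norm H x \<le> hm_norm H (R x)" if "x \<in> hm_carrier H" for x
    using Qbelow[OF that order_refl] Q0[OF that] by simp
  have Rinj: "x = x'" if x: "x \<in> hm_carrier H" and x': "x' \<in> hm_carrier H" and eq: "R x = R x'" for x x'
  proof -
    have "c\<^sup>2 * hm_norm H (x - x') \<le> 0"
      using Rbelow[OF diff_mem[OF x x']] hm_bounded_linear_minus_arg[OF R x x'] eq by simp
    then have "hm_norm H (x - x') = 0"
      using \<open>c\<^sup>2 > 0\<close> hm_norm_nonneg[of H "x - x'"] by (simp add: mult_le_0_iff)
    then show ?thesis using norm_eq_0[OF diff_mem[OF x x']] by simp
  qed
  have "\<exists>x. x \<in> hm_carrier H \<and> R x = S y" if y: "y \<in> hm_carrier K" for y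
    using Rsurj[OF SH[OF y]] by blast
  \<comment> \<open>\<open>L\<close> is the inverse of \<open>R = \<iota>* \<iota>\<close> applied
    after \<open>S\<close>. Injectivity and the lower bound of \<open>R\<close> turn this pointwise
    choice into a bounded linear map.\<close>
  then obtain L where LH: "\<And>y. y \<in> hm_carrier K \<Longrightarrow> L y \<in> hm_carrier H"
    and RL: "\<And>y. y \<in> hm_carrier K \<Longrightarrow> R (L y) = S y" by metis
  obtain A where A: "\<And>y. y \<in> hm_carrier K \<Longrightarrow> hm_norm H (S y) \<le> A * hm_norm K y"
    using hm_bounded_linear_bound[OF S] by blast
  show ?thesis
  proof (rule that[of L])
    show "hm_bounded_linear K H L"
    proof (rule hm_bounded_linearI[where B = "A / c\<^sup>2"])
      show "L x \<in> hm_carrier H" if "x \<in> hm_carrier K" for x by (rule LH[OF that])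
      show "L (x + y) = L x + L y" if x: "x \<in> hm_carrier K" and y: "y \<in> hm_carrier K" for x y
      proof (rule Rinj)
        show "R (L (x + y)) = R (L x + L y)"
          unfolding hm_bounded_linear_add[OF R LH[OF x] LH[OF y]] RL[OF x] RL[OF y]
            RL[OF K.add_mem[OF x y]] by (rule hm_bounded_linear_add[OF S x y])
      qed (intro LH add_mem K.add_mem x y)+
      show "L (hm_act K x a) = hm_act H (L x) a" if x: "x \<in> hm_carrier K" for x a
      proof (rule Rinj)
        show "R (L (hm_act K x a)) = R (hm_act H (L x) a)"
          unfolding hm_bounded_linear_act[OF R LH[OF x]] RL[OF x] RL[OF K.act_mem[OF x]]
          by (rule hm_bounded_linear_act[OF S x])
      qed (intro LH act_mem K.act_mem x)+
      show "hm_norm H (L x) \<le> A / c\<^sup>2 * hm_norm K x" if x: "x \<in> hm_carrier K" for x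
        using Rbelow[OF LH[OF x]] A[OF x] RL[OF x] \<open>c\<^sup>2 > 0\<close> by (simp add: field_simps)
    qed
    show "L (\<iota> x) = x" if x: "x \<in> hm_carrier H" for x
      by (rule Rinj[OF LH[OF iK[OF x]] x]) (use RL[OF iK[OF x]] in \<open>simp add: R_def\<close>)
  qed
qed

end

section \<open>The standard Hilbert module\<close>

lemma star_sum: "star (sum f A) = (\<Sum>i\<in>A. star (f i :: 'a::unital_cstar_algebra))"
  by (induction A rule: infinite_finite_induct) (auto simp: star_add)

text \<open>Blocks of the standard inner product, defined on all sequences. Cauchy-Schwarz and the
  triangle inequality thus hold blockwise before any infinite sum is known to converge.\<close>

definition hm_partial :: "nat set \<Rightarrow> ('a::unital_cstar_algebra, nat \<Rightarrow> 'a) hilbert_module" where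
  "hm_partial I =
    \<lparr> hm_carrier = UNIV, hm_act = (\<lambda>x a n. x n * a), hm_inner = (\<lambda>x y. \<Sum>n\<in>I. star (x n) * y n) \<rparr>"

lemma hm_partial_simps [simp]:
  "hm_carrier (hm_partial I) = UNIV"
  "hm_act (hm_partial I) = (\<lambda>x a n. x n * a)"
  "hm_inner (hm_partial I) x y = (\<Sum>n\<in>I. star (x n) * y n)"
  by (simp_all add: hm_partial_def)

lemma hm_standard_simps [simp]:
  "hm_carrier hm_standard = {x. summable (\<lambda>n. star (x n) * x n)}"
  "hm_act hm_standard = (\<lambda>x a n. x n * a)"
  "hm_inner hm_standard x y = (\<Sum>n. star (x n) * y n)"
  by (simp_all add: hm_standard_def)

lemma semi_hilbert_module_partial: "semi_hilbert_module (hm_partial I)"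
  by unfold_locales
    (auto simp: plus_fun_def zero_fun_def fun_Compl_def distrib_left distrib_right sum.distrib
      sum_distrib_right mult.assoc star_sum star_mult star_star
      intro!: cstar_pos_sum cstar_pos_star_mult_self)

interpretation partial: semi_hilbert_module "hm_partial I" for I
  by (rule semi_hilbert_module_partial)

section \<open>Block norms and the full norm\<close>

lemma hm_partial_norm_mono:
  assumes "I \<subseteq> J" "finite J"
  shows "hm_norm (hm_partial I) x \<le> hm_norm (hm_partial J) x"
proof -
  have "(\<Sum>n\<in>J. star (x n) * x n) = (\<Sum>n\<in>I. star (x n) * x n) + (\<Sum>n\<in>J - I. star (x n) * x n)"
    using assms by (simp add: sum.subset_diff)
  then show ?thesis
    by (simp add: hm_norm_def cstar_pos_norm_mono cstar_pos_sum cstar_pos_star_mult_self)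
qed

lemma hm_partial_norm_tendsto:
  assumes "x \<in> hm_carrier hm_standard"
  shows "(\<lambda>n. hm_norm (hm_partial {..<n}) x) \<longlonglongrightarrow> hm_norm hm_standard x"
  using assms unfolding hm_norm_def hm_partial_simps hm_standard_simps
  by (intro tendsto_intros summable_LIMSEQ) simp

lemma hm_partial_norm_le:
  assumes "x \<in> hm_carrier hm_standard" "finite I"
  shows "hm_norm (hm_partial I) x \<le> hm_norm hm_standard x"
proof -
  obtain m where m: "I \<subseteq> {..<m}" using finite_nat_iff_bounded[of I] assms(2) by blast
  have "hm_norm (hm_partial I) x \<le> hm_norm (hm_partial {..<n}) x" if "m \<le> n" for n
    using m that by (intro hm_partial_norm_mono) auto
  then show ?thesis using hm_partial_norm_tendsto[OF assms(1)] by (intro LIMSEQ_le_const) blast+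
qed

text \<open>The Cauchy criterion in terms of block norms, for which a triangle inequality is
  available; the tolerances change by a square or a root.\<close>

lemma hm_standard_iff_Cauchy:
  "x \<in> hm_carrier hm_standard \<longleftrightarrow>
    (\<forall>e>0. \<exists>N. \<forall>m\<ge>N. \<forall>n. hm_norm (hm_partial {m..<n}) x < e)"
proof -
  have "x \<in> hm_carrier hm_standard \<longleftrightarrow>
      (\<forall>e>0. \<exists>N. \<forall>m\<ge>N. \<forall>n. norm (\<Sum>k\<in>{m..<n}. star (x k) * x k) < e)"
    by (simp add: summable_Cauchy)
  also have "\<dots> \<longleftrightarrow> (\<forall>e>0. \<exists>N. \<forall>m\<ge>N. \<forall>n. hm_norm (hm_partial {m..<n}) x < e)"
  proof safe
    fix e :: real assume "e > 0"
      and *: "\<forall>e>0. \<exists>N. \<forall>m\<ge>N. \<forall>n. norm (\<Sum>k\<in>{m..<n}. star (x k) * x k) < e"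
    then obtain N where N: "\<And>m n. N \<le> m \<Longrightarrow> norm (\<Sum>k\<in>{m..<n}. star (x k) * x k) < e\<^sup>2"
      by (meson zero_less_power)
    have "hm_norm (hm_partial {m..<n}) x < e" if "N \<le> m" for m n
      using N[OF that, of n] \<open>e > 0\<close> by (simp add: hm_norm_def real_less_lsqrt)
    then show "\<exists>N. \<forall>m\<ge>N. \<forall>n. hm_norm (hm_partial {m..<n}) x < e" by blast
  next
    fix e :: real assume "e > 0"
      and *: "\<forall>e>0. \<exists>N. \<forall>m\<ge>N. \<forall>n. hm_norm (hm_partial {m..<n}) x < e"
    then obtain N where N: "\<And>m n. N \<le> m \<Longrightarrow> hm_norm (hm_partial {m..<n}) x < sqrt e"
      by (meson real_sqrt_gt_zero)
    have "norm (\<Sum>k\<in>{m..<n}. star (x k) * x k) < e" if "N \<le> m" for m n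
      using N[OF that, of n] by (simp add: hm_norm_def)
    then show "\<exists>N. \<forall>m\<ge>N. \<forall>n. norm (\<Sum>k\<in>{m..<n}. star (x k) * x k) < e" by blast
  qed
  finally show ?thesis .
qed

text \<open>Cauchy-Schwarz on a block bounds a partial sum by the product of two tail norms, each
  below \<open>sqrt e\<close>.\<close>

lemma hm_standard_summable_inner:
  assumes "x \<in> hm_carrier hm_standard" "y \<in> hm_carrier hm_standard"
  shows "summable (\<lambda>n. star (x n) * y n)"
  unfolding summable_Cauchy
proof (intro allI impI)
  fix e :: real assume "e > 0"
  then have e: "sqrt e > 0" by simp
  obtain N where N: "\<And>m n. N \<le> m \<Longrightarrow> hm_norm (hm_partial {m..<n}) x < sqrt e"
    using assms(1) e unfolding hm_standard_iff_Cauchy by blast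
  obtain M where M: "\<And>m n. M \<le> m \<Longrightarrow> hm_norm (hm_partial {m..<n}) y < sqrt e"
    using assms(2) e unfolding hm_standard_iff_Cauchy by blast
  have "norm (\<Sum>k\<in>{m..<n}. star (x k) * y k) < e" if "max N M \<le> m" for m n
  proof -
    have "norm (\<Sum>k\<in>{m..<n}. star (x k) * y k)
        \<le> hm_norm (hm_partial {m..<n}) x * hm_norm (hm_partial {m..<n}) y"
      using partial.Cauchy_Schwarz[of x "{m..<n}" y] by simp
    also have "\<dots> < sqrt e * sqrt e"
      using N[of m n] M[of m n] that by (intro mult_strict_mono') auto
    finally show ?thesis using \<open>e > 0\<close> by simp
  qed
  then show "\<exists>N. \<forall>m\<ge>N. \<forall>n. norm (\<Sum>k\<in>{m..<n}. star (x k) * y k) < e" by blast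
qed

lemma semi_hilbert_module_standard:
  "semi_hilbert_module (hm_standard :: ('a::unital_cstar_algebra, nat \<Rightarrow> 'a) hilbert_module)"
  (is "semi_hilbert_module ?H")
proof
  note [simp] = plus_fun_def zero_fun_def fun_Compl_def
  note s = hm_standard_summable_inner
  show "0 \<in> hm_carrier ?H" by simp
  show "x + y \<in> hm_carrier ?H" if "x \<in> hm_carrier ?H" "y \<in> hm_carrier ?H" for x y
    using that s[of x y] s[of y x]
    by (simp add: star_add distrib_left distrib_right summable_add)
  show "hm_act ?H x a \<in> hm_carrier ?H" if "x \<in> hm_carrier ?H" for x a
  proof -
    have "summable (\<lambda>n. star a * (star (x n) * x n) * a)"
      using that by (intro summable_mult summable_mult2) simp
    then show ?thesis by (simp add: star_mult mult.assoc)
  qed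
  show "hm_act ?H x (- 1) = - x" for x by (simp add: fun_eq_iff)
  show "hm_act ?H (x + y) a = hm_act ?H x a + hm_act ?H y a" for x y a
    by (simp add: distrib_right)
  show "hm_act ?H x (a + b) = hm_act ?H x a + hm_act ?H x b" for x a b
    by (simp add: distrib_left)
  show "hm_act ?H (hm_act ?H x a) b = hm_act ?H x (a * b)" for x a b
    by (simp add: mult.assoc)
  show "hm_inner ?H x (y + z) = hm_inner ?H x y + hm_inner ?H x z"
    if "x \<in> hm_carrier ?H" "y \<in> hm_carrier ?H" "z \<in> hm_carrier ?H" for x y z
    using suminf_add[OF s[OF that(1,2)] s[OF that(1,3)]] by (simp add: distrib_left)
  show "hm_inner ?H x (hm_act ?H y a) = hm_inner ?H x y * a"
    if "x \<in> hm_carrier ?H" "y \<in> hm_carrier ?H" for x y a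
    using suminf_mult2[OF s[OF that], of a] by (simp add: mult.assoc)
  show "star (hm_inner ?H x y) = hm_inner ?H y x"
    if "x \<in> hm_carrier ?H" "y \<in> hm_carrier ?H" for x y
    using bounded_linear.suminf[OF bounded_linear_star s[OF that]] by (simp add: star_mult star_star)
  show "cstar_pos (hm_inner ?H x x)" if "x \<in> hm_carrier ?H" for x
  proof (rule cstar_pos_lim)
    show "(\<lambda>n. \<Sum>k<n. star (x k) * x k) \<longlonglongrightarrow> hm_inner ?H x x"
      using summable_LIMSEQ[OF s[OF that that]] by simp
  qed (intro cstar_pos_sum cstar_pos_star_mult_self)
qed

interpretation standard: semi_hilbert_module
  "hm_standard :: ('a::unital_cstar_algebra, nat \<Rightarrow> 'a) hilbert_module"
  by (rule semi_hilbert_module_standard)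

lemma hm_partial_norm_singleton: "hm_norm (hm_partial {n}) x = norm (x n)"
  by (simp add: hm_norm_def norm_star_mult_self)

text \<open>Every coordinate is bounded by the module norm, so a Cauchy sequence has a
  coordinatewise limit. Estimates uniform over finite blocks then show that the limit is in the
  module and that convergence is in norm.\<close>

theorem complete_hilbert_module_standard:
  "complete_hilbert_module (hm_standard :: ('a::unital_cstar_algebra, nat \<Rightarrow> 'a) hilbert_module)"
  (is "complete_hilbert_module ?H")
proof
  have le: "norm (x n) \<le> hm_norm ?H x" if "x \<in> hm_carrier ?H" for x n
    using hm_partial_norm_le[OF that, of "{n}"] by (simp add: hm_partial_norm_singleton)
  show "x = 0" if "x \<in> hm_carrier ?H" "hm_inner ?H x x = 0" for x
  proof
    show "x n = 0 n" for n
      using le[OF that(1), of n] that(2) by (simp add: hm_norm_def zero_fun_def del: hm_standard_simps)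
  qed
  fix X :: "nat \<Rightarrow> nat \<Rightarrow> 'a"
  assume X: "\<And>n. X n \<in> hm_carrier ?H"
    and C: "\<And>e. e > 0 \<Longrightarrow> \<exists>N. \<forall>m\<ge>N. \<forall>n\<ge>N. hm_norm ?H (X m - X n) < e"
  have "Cauchy (\<lambda>n. X n k)" for k
  proof (rule CauchyI)
    fix e :: real assume "e > 0"
    then obtain N where N: "\<And>m n. N \<le> m \<Longrightarrow> N \<le> n \<Longrightarrow> hm_norm ?H (X m - X n) < e"
      using C by blast
    have "norm (X m k - X n k) < e" if "N \<le> m" "N \<le> n" for m n
      using le_less_trans[OF le[OF standard.diff_mem[OF X X]] N[OF that], of k] by simp
    then show "\<exists>M. \<forall>m\<ge>M. \<forall>n\<ge>M. norm (X m k - X n k) < e" by blast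
  qed
  then have "\<exists>l. (\<lambda>n. X n k) \<longlonglongrightarrow> l" for k
    by (simp add: Cauchy_convergent_iff convergent_def)
  then obtain x where x: "\<And>k. (\<lambda>n. X n k) \<longlonglongrightarrow> x k" by metis
  \<comment> \<open>A block norm is at most the full norm and depends continuously on finitely many
    coordinates, so the Cauchy estimate passes to the limit with the same index \<open>N\<close> for
    all finite \<open>I\<close>.\<close>
  have part: "\<exists>N. \<forall>m\<ge>N. \<forall>I. finite I \<longrightarrow> hm_norm (hm_partial I) (X m - x) \<le> e" if "e > 0" for e
  proof -
    obtain N where N: "\<And>m n. N \<le> m \<Longrightarrow> N \<le> n \<Longrightarrow> hm_norm ?H (X m - X n) < e"
      using C[OF \<open>e > 0\<close>] by blast
    have "hm_norm (hm_partial I) (X m - x) \<le> e" if m: "N \<le> m" and I: "finite I" for m I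
    proof (rule LIMSEQ_le_const2)
      show "(\<lambda>n. hm_norm (hm_partial I) (X m - X n)) \<longlonglongrightarrow> hm_norm (hm_partial I) (X m - x)"
        unfolding hm_norm_def hm_partial_simps minus_apply
        by (intro tendsto_intros bounded_linear.tendsto[OF bounded_linear_star] x)
      have "hm_norm (hm_partial I) (X m - X n) \<le> e" if "N \<le> n" for n
        using hm_partial_norm_le[OF standard.diff_mem[OF X X] I, of m n] N[OF m that] by simp
      then show "\<exists>M. \<forall>n\<ge>M. hm_norm (hm_partial I) (X m - X n) \<le> e" by blast
    qed
    then show ?thesis by blast
  qed
  have xH: "x \<in> hm_carrier ?H"
    unfolding hm_standard_iff_Cauchy
  proof (intro allI impI)
    fix e :: real assume "e > 0"
    then have e: "e / 2 > 0" by simp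
    obtain N where N: "\<And>I. finite I \<Longrightarrow> hm_norm (hm_partial I) (X N - x) \<le> e / 2"
      using part[OF e] by blast
    obtain M where M: "\<And>m n. M \<le> m \<Longrightarrow> hm_norm (hm_partial {m..<n}) (X N) < e / 2"
      using X[of N] e unfolding hm_standard_iff_Cauchy by blast
    \<comment> \<open>Write \<open>x\<close> as \<open>X N\<close> minus \<open>X N - x\<close>: the
      first has small tails, the second is small on every finite block.\<close>
    have "hm_norm (hm_partial {m..<n}) x < e" if "M \<le> m" for m n
      using partial.norm_triangle_diff[of "X N" "{m..<n}" "X N - x"] N[of "{m..<n}"] M[OF that, of n]
      by simp
    then show "\<exists>N. \<forall>m\<ge>N. \<forall>n. hm_norm (hm_partial {m..<n}) x < e" by blast
  qed
  have "(\<lambda>n. hm_norm ?H (X n - x)) \<longlonglongrightarrow> 0"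
  proof (rule LIMSEQ_I)
    fix e :: real assume "e > 0"
    then have e: "e / 2 > 0" by simp
    obtain N where N: "\<And>m I. N \<le> m \<Longrightarrow> finite I \<Longrightarrow> hm_norm (hm_partial I) (X m - x) \<le> e / 2"
      using part[OF e] by blast
    have "hm_norm ?H (X m - x) \<le> e / 2" if "N \<le> m" for m
      using N[OF that] by (intro LIMSEQ_le_const2[OF hm_partial_norm_tendsto[OF standard.diff_mem[OF X xH]]])
        blast
    then have "norm (hm_norm ?H (X m - x) - 0) < e" if "N \<le> m" for m
      using that \<open>e > 0\<close> by (smt (verit) hm_norm_nonneg real_norm_def field_sum_of_halves)
    then show "\<exists>N. \<forall>n\<ge>N. norm (hm_norm ?H (X n - x) - 0) < e" by blast
  qed
  then show "\<exists>x\<in>hm_carrier ?H. (\<lambda>n. hm_norm ?H (X n - x)) \<longlonglongrightarrow> 0" using xH by blast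
qed

section \<open>Orthogonal direct sums\<close>

lemma semi_hilbert_module_sum:
  assumes "semi_hilbert_module H" "semi_hilbert_module K"
  shows "semi_hilbert_module (hm_sum H K)"
proof -
  interpret H: semi_hilbert_module H by fact
  interpret K: semi_hilbert_module K by fact
  show ?thesis
    by unfold_locales
      (auto simp: zero_prod_def H.add_mem K.add_mem H.act_mem K.act_mem H.act_minus_one
        K.act_minus_one H.act_add_left K.act_add_left H.act_add_right K.act_add_right
        H.act_act K.act_act H.inner_add_right K.inner_add_right H.inner_act_right K.inner_act_right
        distrib_right star_add H.star_inner K.star_inner cstar_pos_add H.inner_pos K.inner_pos)
qed

lemma hm_norm_fst_le:
  assumes "semi_hilbert_module H" "semi_hilbert_module K" "z \<in> hm_carrier (hm_sum H K)"
  shows "hm_norm H (fst z) \<le> hm_norm (hm_sum H K) z"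
  using assms by (auto simp: hm_norm_def intro!: cstar_pos_norm_mono semi_hilbert_module.inner_pos)

lemma hm_norm_snd_le:
  assumes "semi_hilbert_module H" "semi_hilbert_module K" "z \<in> hm_carrier (hm_sum H K)"
  shows "hm_norm K (snd z) \<le> hm_norm (hm_sum H K) z"
proof -
  have "norm (hm_inner K (snd z) (snd z)) \<le> norm (hm_inner K (snd z) (snd z) + hm_inner H (fst z) (fst z))"
    using assms by (auto intro!: cstar_pos_norm_mono semi_hilbert_module.inner_pos)
  then show ?thesis by (simp add: hm_norm_def add.commute)
qed

text \<open>The norm of a pair is the root of the norm of a sum in the algebra, which the triangle
  inequality only estimates; there is no Pythagorean equality in general.\<close>

lemma hm_norm_sum_le: "hm_norm (hm_sum H K) (x, y) \<le> hm_norm H x + hm_norm K y"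
proof (rule power2_le_imp_le)
  have "(hm_norm (hm_sum H K) (x, y))\<^sup>2 \<le> (hm_norm H x)\<^sup>2 + (hm_norm K y)\<^sup>2"
    unfolding hm_norm_power2 by (simp add: norm_triangle_ineq)
  also have "\<dots> \<le> (hm_norm H x + hm_norm K y)\<^sup>2" by (simp add: power2_sum)
  finally show "(hm_norm (hm_sum H K) (x, y))\<^sup>2 \<le> (hm_norm H x + hm_norm K y)\<^sup>2" .
qed simp

lemma hm_bounded_linear_fst:
  assumes "semi_hilbert_module H" "semi_hilbert_module K"
  shows "hm_bounded_linear (hm_sum H K) H fst"
  using hm_norm_fst_le[OF assms] by (intro hm_bounded_linearI[where B = 1]) auto

lemma hm_bounded_linear_snd:
  assumes "semi_hilbert_module H" "semi_hilbert_module K"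
  shows "hm_bounded_linear (hm_sum H K) K snd"
  using hm_norm_snd_le[OF assms] by (intro hm_bounded_linearI[where B = 1]) auto

lemma hm_bounded_linear_pair:
  assumes T: "hm_bounded_linear X H T" and S: "hm_bounded_linear X K S"
  shows "hm_bounded_linear X (hm_sum H K) (\<lambda>x. (T x, S x))"
proof -
  obtain B where B: "\<And>x. x \<in> hm_carrier X \<Longrightarrow> hm_norm H (T x) \<le> B * hm_norm X x"
    using hm_bounded_linear_bound[OF T] by blast
  obtain A where A: "\<And>x. x \<in> hm_carrier X \<Longrightarrow> hm_norm K (S x) \<le> A * hm_norm X x"
    using hm_bounded_linear_bound[OF S] by blast
  show ?thesis
  proof (rule hm_bounded_linearI[where B = "B + A"])
    fix x assume x: "x \<in> hm_carrier X"
    show "hm_norm (hm_sum H K) (T x, S x) \<le> (B + A) * hm_norm X x"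
      using hm_norm_sum_le[of H K "T x" "S x"] A[OF x] B[OF x] by (simp add: distrib_right)
  qed (simp_all add: hm_bounded_linear_mem[OF T] hm_bounded_linear_mem[OF S]
      hm_bounded_linear_add[OF T] hm_bounded_linear_add[OF S]
      hm_bounded_linear_act[OF T] hm_bounded_linear_act[OF S])
qed

section \<open>Finitely generated modules\<close>

text \<open>Members of an indexed family may coincide, whereas the definition uses a set of
  generators; the coefficients over each fibre of \<open>f\<close> are therefore added up.\<close>

lemma (in semi_hilbert_module) hm_finitely_generatedI:
  assumes "finite I" and f: "\<And>i. i \<in> I \<Longrightarrow> f i \<in> hm_carrier H"
    and gen: "\<And>x. x \<in> hm_carrier H \<Longrightarrow> \<exists>a. x = (\<Sum>i\<in>I. hm_act H (f i) (a i))"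
  shows "hm_finitely_generated H"
  unfolding hm_finitely_generated_def
proof (intro exI[of _ "f ` I"] conjI equalityI subsetI)
  show "finite (f ` I)" using \<open>finite I\<close> by simp
  show "x \<in> hm_carrier H" if "x \<in> f ` I" for x using f that by auto
next
  fix x assume "x \<in> hm_carrier H"
  then obtain a where "x = (\<Sum>i\<in>I. hm_act H (f i) (a i))" using gen by blast
  also have "\<dots> = (\<Sum>g\<in>f ` I. \<Sum>i\<in>{i \<in> I. f i = g}. hm_act H (f i) (a i))"
    by (rule sum.image_gen[OF \<open>finite I\<close>])
  also have "\<dots> = (\<Sum>g\<in>f ` I. hm_act H g (\<Sum>i\<in>{i \<in> I. f i = g}. a i))"
  proof (rule sum.cong[OF refl])
    fix g assume g: "g \<in> f ` I"
    have "(\<Sum>i\<in>{i \<in> I. f i = g}. hm_act H (f i) (a i)) = (\<Sum>i\<in>{i \<in> I. f i = g}. hm_act H g (a i))"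
      by (rule sum.cong) simp_all
    also have "\<dots> = hm_act H g (\<Sum>i\<in>{i \<in> I. f i = g}. a i)"
      using g f by (intro act_sum_right[symmetric]) auto
    finally show "(\<Sum>i\<in>{i \<in> I. f i = g}. hm_act H (f i) (a i))
        = hm_act H g (\<Sum>i\<in>{i \<in> I. f i = g}. a i)" .
  qed
  finally show "x \<in> {\<Sum>g\<in>f ` I. hm_act H g (a g) | a. True}"
    by (intro CollectI exI[of _ "\<lambda>g. \<Sum>i\<in>{i \<in> I. f i = g}. a i"]) simp
next
  fix x assume "x \<in> {\<Sum>g\<in>f ` I. hm_act H g (a g) | a. True}"
  then obtain a where "x = (\<Sum>g\<in>f ` I. hm_act H g (a g))" by blast
  then show "x \<in> hm_carrier H" using f by (auto intro!: sum_mem act_mem)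
qed

lemma hm_finitely_generatedE:
  assumes "hm_finitely_generated H"
  obtains G where "finite G" "G \<subseteq> hm_carrier H"
    "\<And>x. x \<in> hm_carrier H \<Longrightarrow> \<exists>a. x = (\<Sum>g\<in>G. hm_act H g (a g))"
proof -
  obtain G where G: "finite G" "G \<subseteq> hm_carrier H"
    and eq: "hm_carrier H = {\<Sum>g\<in>G. hm_act H g (a g) | a. True}"
    using assms unfolding hm_finitely_generated_def by blast
  have "\<exists>a. x = (\<Sum>g\<in>G. hm_act H g (a g))" if "x \<in> hm_carrier H" for x
    using subsetD[OF equalityD1[OF eq] that] by blast
  then show ?thesis using that G by blast
qed

lemma hm_finitely_generated_image:
  assumes "semi_hilbert_module H" "semi_hilbert_module K" "hm_finitely_generated H"
    and T: "hm_bounded_linear H K T" and surj: "hm_carrier K \<subseteq> T ` hm_carrier H"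
  shows "hm_finitely_generated K"
proof -
  interpret H: semi_hilbert_module H by fact
  interpret K: semi_hilbert_module K by fact
  obtain G where G: "finite G" "G \<subseteq> hm_carrier H"
    "\<And>x. x \<in> hm_carrier H \<Longrightarrow> \<exists>a. x = (\<Sum>g\<in>G. hm_act H g (a g))"
    using hm_finitely_generatedE[OF assms(3)] by blast
  have Tsum: "T (\<Sum>g\<in>A. hm_act H g (a g)) = (\<Sum>g\<in>A. hm_act K (T g) (a g))"
    if "A \<subseteq> hm_carrier H" "finite A" for a A
    using that(2,1)
  proof (induction A rule: finite_induct)
    case empty
    show ?case using H.hm_bounded_linear_zero[OF T] by simp
  next
    case (insert g A)
    then have g: "g \<in> hm_carrier H" and A: "(\<Sum>g\<in>A. hm_act H g (a g)) \<in> hm_carrier H"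
      by (auto intro!: H.sum_mem H.act_mem)
    show ?case
      using insert hm_bounded_linear_add[OF T H.act_mem[OF g, of "a g"] A] hm_bounded_linear_act[OF T g, of "a g"]
      by simp
  qed
  show ?thesis
  proof (rule K.hm_finitely_generatedI[of G T])
    show "T g \<in> hm_carrier K" if "g \<in> G" for g
      using hm_bounded_linear_mem[OF T] G(2) that by blast
    fix y assume "y \<in> hm_carrier K"
    then obtain x where x: "x \<in> hm_carrier H" "y = T x" using surj by blast
    then obtain a where "x = (\<Sum>g\<in>G. hm_act H g (a g))" using G(3) by blast
    then have "y = (\<Sum>g\<in>G. hm_act K (T g) (a g))" using Tsum[OF G(2,1)] x(2) by simp
    then show "\<exists>a. y = (\<Sum>g\<in>G. hm_act K (T g) (a g))" by blast
  qed (rule G(1))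
qed

lemma hm_finitely_generated_sum:
  assumes "semi_hilbert_module H" "semi_hilbert_module K"
    and "hm_finitely_generated H" "hm_finitely_generated K"
  shows "hm_finitely_generated (hm_sum H K)"
proof -
  interpret H: semi_hilbert_module H by fact
  interpret K: semi_hilbert_module K by fact
  interpret S: semi_hilbert_module "hm_sum H K" by (rule semi_hilbert_module_sum[OF assms(1,2)])
  obtain G where G: "finite G" "G \<subseteq> hm_carrier H"
    "\<And>x. x \<in> hm_carrier H \<Longrightarrow> \<exists>a. x = (\<Sum>g\<in>G. hm_act H g (a g))"
    using hm_finitely_generatedE[OF assms(3)] by blast
  obtain G' where G': "finite G'" "G' \<subseteq> hm_carrier K"
    "\<And>x. x \<in> hm_carrier K \<Longrightarrow> \<exists>a. x = (\<Sum>g\<in>G'. hm_act K g (a g))"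
    using hm_finitely_generatedE[OF assms(4)] by blast
  let ?f = "case_sum (\<lambda>g. (g, 0)) (\<lambda>g. (0, g))"
  show ?thesis
  proof (rule S.hm_finitely_generatedI[of "G <+> G'" ?f])
    show "finite (G <+> G')" using G(1) G'(1) by simp
    show "?f i \<in> hm_carrier (hm_sum H K)" if "i \<in> G <+> G'" for i
      using that G(2) G'(2) by auto
    fix z assume "z \<in> hm_carrier (hm_sum H K)"
    then obtain a b where ab: "fst z = (\<Sum>g\<in>G. hm_act H g (a g))" "snd z = (\<Sum>g\<in>G'. hm_act K g (b g))"
      using G(3) G'(3) by fastforce
    have "z = (\<Sum>i\<in>G <+> G'. hm_act (hm_sum H K) (?f i) (case_sum a b i))"
      using G(1) G'(1) by (intro prod_eqI) (simp_all add: sum.Plus fst_sum snd_sum ab)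
    then show "\<exists>a. z = (\<Sum>i\<in>G <+> G'. hm_act (hm_sum H K) (?f i) (a i))" by blast
  qed
qed

section \<open>Upper triangular operators\<close>

lemma upper_triangular_apply [simp]:
  "upper_triangular F C D z = (F (fst z) + C (snd z), D (snd z))"
  by (simp add: upper_triangular_def case_prod_beta)

context semi_hilbert_module
begin

section \<open>Operator matrices and their adjoints\<close>

lemma hm_bounded_linear_compose_fst:
  "hm_bounded_linear H K T \<Longrightarrow> hm_bounded_linear (hm_sum H H) K (\<lambda>z. T (fst z))"
  by (rule hm_bounded_linear_compose[OF hm_bounded_linear_fst]; unfold_locales)

lemma hm_bounded_linear_compose_snd:
  "hm_bounded_linear H K T \<Longrightarrow> hm_bounded_linear (hm_sum H H) K (\<lambda>z. T (snd z))"
  by (rule hm_bounded_linear_compose[OF hm_bounded_linear_snd]; unfold_locales)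

lemma upper_triangular_adjointable:
  assumes F: "F \<in> hm_adjointable H H" and C: "C \<in> hm_adjointable H H" and D: "D \<in> hm_adjointable H H"
  shows "upper_triangular F C D \<in> hm_adjointable (hm_sum H H) (hm_sum H H)"
proof -
  note bl = hm_adjointable_bounded_linear
  note mem = hm_bounded_linear_mem[OF bl]
  obtain F' where F': "\<And>x. x \<in> hm_carrier H \<Longrightarrow> F' x \<in> hm_carrier H"
    "\<And>x y. x \<in> hm_carrier H \<Longrightarrow> y \<in> hm_carrier H \<Longrightarrow> hm_inner H (F x) y = hm_inner H x (F' y)"
    using F unfolding hm_adjointable_def by blast
  obtain C' where C': "\<And>x. x \<in> hm_carrier H \<Longrightarrow> C' x \<in> hm_carrier H"
    "\<And>x y. x \<in> hm_carrier H \<Longrightarrow> y \<in> hm_carrier H \<Longrightarrow> hm_inner H (C x) y = hm_inner H x (C' y)"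
    using C unfolding hm_adjointable_def by blast
  obtain D' where D': "\<And>x. x \<in> hm_carrier H \<Longrightarrow> D' x \<in> hm_carrier H"
    "\<And>x y. x \<in> hm_carrier H \<Longrightarrow> y \<in> hm_carrier H \<Longrightarrow> hm_inner H (D x) y = hm_inner H x (D' y)"
    using D unfolding hm_adjointable_def by blast
  have "hm_bounded_linear (hm_sum H H) (hm_sum H H) (\<lambda>z. (F (fst z) + C (snd z), D (snd z)))"
    by (intro hm_bounded_linear_pair hm_bounded_linear_plus hm_bounded_linear_compose_fst
        hm_bounded_linear_compose_snd bl F C D)
  moreover have "upper_triangular F C D = (\<lambda>z. (F (fst z) + C (snd z), D (snd z)))"
    by (simp add: fun_eq_iff)
  ultimately have "hm_bounded_linear (hm_sum H H) (hm_sum H H) (upper_triangular F C D)" by simp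
  \<comment> \<open>The adjoint is the lower triangular matrix of entrywise adjoints.\<close>
  moreover have "\<exists>S. S ` hm_carrier (hm_sum H H) \<subseteq> hm_carrier (hm_sum H H) \<and>
      (\<forall>z\<in>hm_carrier (hm_sum H H). \<forall>w\<in>hm_carrier (hm_sum H H).
        hm_inner (hm_sum H H) (upper_triangular F C D z) w = hm_inner (hm_sum H H) z (S w))"
  proof (intro exI[of _ "\<lambda>w. (F' (fst w), C' (fst w) + D' (snd w))"] conjI ballI image_subsetI)
    fix z w assume z: "z \<in> hm_carrier (hm_sum H H)" and w: "w \<in> hm_carrier (hm_sum H H)"
    have zw: "fst z \<in> hm_carrier H" "snd z \<in> hm_carrier H" "fst w \<in> hm_carrier H" "snd w \<in> hm_carrier H"
      using z w by auto
    show "hm_inner (hm_sum H H) (upper_triangular F C D z) w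
        = hm_inner (hm_sum H H) z (F' (fst w), C' (fst w) + D' (snd w))"
      using inner_add_left[OF zw(3) mem[OF F zw(1)] mem[OF C zw(2)]]
        inner_add_right[OF zw(2) C'(1)[OF zw(3)] D'(1)[OF zw(4)]]
        F'(2)[OF zw(1,3)] C'(2)[OF zw(2,3)] D'(2)[OF zw(2,4)] by (simp add: add.assoc)
  next
    fix w assume "w \<in> hm_carrier (hm_sum H H)"
    then show "(F' (fst w), C' (fst w) + D' (snd w)) \<in> hm_carrier (hm_sum H H)"
      by (auto intro!: F'(1) add_mem C'(1) D'(1))
  qed
  ultimately show ?thesis unfolding hm_adjointable_def hm_bounded_linear_def by blast
qed

lemma hm_adjointable_zero: "(\<lambda>_. 0) \<in> hm_adjointable H H"
  unfolding hm_adjointable_def hm_linear_def hm_bounded_def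
  by (auto simp: inner_zero_left inner_zero_right intro!: exI[of _ 0] exI[of _ "\<lambda>_. 0"])

end

context complete_hilbert_module
begin

lemma upper_semi_fredholm_sum:
  assumes F: "F \<in> upper_semi_fredholm H" and D: "D \<in> upper_semi_fredholm H"
  shows "upper_triangular F (\<lambda>_. 0) D \<in> upper_semi_fredholm (hm_sum H H)"
proof -
  let ?HH = "hm_sum H H" and ?T = "upper_triangular F (\<lambda>_. 0) D"
  interpret HH: semi_hilbert_module ?HH
    by (rule semi_hilbert_module_sum) unfold_locales
  obtain M1 N1 M2 N2 where dF: "hm_decomposition H M1 N1" "hm_decomposition H M2 N2"
      "F ` M1 \<subseteq> M2" "F ` N1 \<subseteq> N2"
    and iF: "hm_isomorphism (hm_restrict H M1) (hm_restrict H M2) F"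
    and fgF: "hm_finitely_generated (hm_restrict H N1)" and aF: "F \<in> hm_adjointable H H"
    using F unfolding upper_semi_fredholm_def hm_diagonal_def by blast
  obtain M1' N1' M2' N2' where dD: "hm_decomposition H M1' N1'" "hm_decomposition H M2' N2'"
      "D ` M1' \<subseteq> M2'" "D ` N1' \<subseteq> N2'"
    and iD: "hm_isomorphism (hm_restrict H M1') (hm_restrict H M2') D"
    and fgD: "hm_finitely_generated (hm_restrict H N1')" and aD: "D \<in> hm_adjointable H H"
    using D unfolding upper_semi_fredholm_def hm_diagonal_def by blast
  \<comment> \<open>This is the product of the two submodules, written as an intersection of
    preimages so that closedness is inherited.\<close>
  define S where "S M M' = {z \<in> hm_carrier ?HH. fst z \<in> M} \<inter> {z \<in> hm_carrier ?HH. snd z \<in> M'}" for M M'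
  note fst_bl = hm_bounded_linear_compose_fst[OF hm_bounded_linear_id]
  note snd_bl = hm_bounded_linear_compose_snd[OF hm_bounded_linear_id]
  have closed: "hm_closed_submodule ?HH (S M M')"
    if "hm_closed_submodule H M" "hm_closed_submodule H M'" for M M'
    unfolding S_def using that
    by (intro hm_closed_submodule_Int HH.hm_closed_submodule_preimage[OF _ fst_bl]
        HH.hm_closed_submodule_preimage[OF _ snd_bl])
  have sub: "M \<subseteq> hm_carrier H" "hm_submodule H M" if "hm_closed_submodule H M" for M
    using that by (simp_all add: hm_closed_submodule_def hm_submodule_def)
  have carrier_S: "S M M' = M \<times> M'"
    if "hm_closed_submodule H M" "hm_closed_submodule H M'" for M M'
    using sub(1)[OF that(1)] sub(1)[OF that(2)] by (auto simp: S_def)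
  have restrict_S: "hm_restrict ?HH (S M M') = hm_sum (hm_restrict H M) (hm_restrict H M')"
    if "hm_closed_submodule H M" "hm_closed_submodule H M'" for M M'
    using carrier_S[OF that] by (simp add: hm_restrict_def hm_sum_def)
  have dec: "hm_decomposition ?HH (S M M') (S N N')"
    if d: "hm_decomposition H M N" and d': "hm_decomposition H M' N'" for M N M' N'
  proof (rule hm_decompositionI)
    note c = hm_decompositionD(1,2)[OF d] hm_decompositionD(1,2)[OF d']
    show "hm_closed_submodule ?HH (S M M')" by (rule closed[OF c(1,3)])
    show "hm_closed_submodule ?HH (S N N')" by (rule closed[OF c(2,4)])
    show "z = 0" if z: "z \<in> S M M'" "z \<in> S N N'" for z
    proof -
      have "fst z \<in> M \<inter> N" "snd z \<in> M' \<inter> N'" using z by (simp_all add: S_def)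
      then show ?thesis
        unfolding hm_decompositionD(3)[OF d] hm_decompositionD(3)[OF d'] by (simp add: prod_eq_iff)
    qed
    show "\<exists>m\<in>S M M'. \<exists>n\<in>S N N'. z = m + n" if z: "z \<in> hm_carrier ?HH" for z
    proof -
      have zz: "fst z \<in> hm_carrier H" "snd z \<in> hm_carrier H" using z by auto
      obtain m n where mn: "m \<in> M" "n \<in> N" "fst z = m + n"
        using hm_decompositionD(4)[OF d zz(1)] by blast
      obtain m' n' where mn': "m' \<in> M'" "n' \<in> N'" "snd z = m' + n'"
        using hm_decompositionD(4)[OF d' zz(2)] by blast
      show ?thesis
        unfolding carrier_S[OF c(1,3)] carrier_S[OF c(2,4)]
        by (rule bexI[of _ "(m, m')"], rule bexI[of _ "(n, n')"])
          (use mn mn' in \<open>simp_all add: prod_eq_iff\<close>)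
    qed
  qed (rule HH.add_mem)
  note cF = hm_decompositionD(1,2)[OF dF(1)] hm_decompositionD(1,2)[OF dF(2)]
  note cD = hm_decompositionD(1,2)[OF dD(1)] hm_decompositionD(1,2)[OF dD(2)]
  note sm = semi_hilbert_module_restrict[OF sub(2)]
  obtain F' where F': "hm_bounded_linear (hm_restrict H M2) (hm_restrict H M1) F'"
    "\<And>x. x \<in> M1 \<Longrightarrow> F' (F x) = x" "\<And>y. y \<in> M2 \<Longrightarrow> F (F' y) = y"
    using hm_isomorphism_inverse[OF iF sm[OF cF(1)]] by auto
  obtain D' where D': "hm_bounded_linear (hm_restrict H M2') (hm_restrict H M1') D'"
    "\<And>x. x \<in> M1' \<Longrightarrow> D' (D x) = x" "\<And>y. y \<in> M2' \<Longrightarrow> D (D' y) = y"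
    using hm_isomorphism_inverse[OF iD sm[OF cD(1)]] by auto
  have bF: "hm_bounded_linear (hm_restrict H M1) (hm_restrict H M2) F"
    and bD: "hm_bounded_linear (hm_restrict H M1') (hm_restrict H M2') D"
    using iF iD by (simp_all add: hm_isomorphism_def hm_bounded_linear_def)
  have pair: "hm_bounded_linear (hm_sum (hm_restrict H M) (hm_restrict H M'))
      (hm_sum (hm_restrict H K) (hm_restrict H K')) (\<lambda>z. (A (fst z), B (snd z)))"
    if "hm_closed_submodule H M" "hm_closed_submodule H M'"
      "hm_bounded_linear (hm_restrict H M) (hm_restrict H K) A"
      "hm_bounded_linear (hm_restrict H M') (hm_restrict H K') B" for M M' K K' A B
    by (intro hm_bounded_linear_pair
        hm_bounded_linear_compose[OF hm_bounded_linear_fst[OF sm[OF that(1)] sm[OF that(2)]] that(3)]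
        hm_bounded_linear_compose[OF hm_bounded_linear_snd[OF sm[OF that(1)] sm[OF that(2)]] that(4)])
  have T: "?T = (\<lambda>z. (F (fst z), D (snd z)))" by (simp add: fun_eq_iff)
  have iso: "hm_isomorphism (hm_restrict ?HH (S M1 M1')) (hm_restrict ?HH (S M2 M2')) ?T"
    unfolding restrict_S[OF cF(1) cD(1)] restrict_S[OF cF(3) cD(3)] T
  proof (rule hm_isomorphismI[where S = "\<lambda>z. (F' (fst z), D' (snd z))"])
    show "hm_bounded (hm_sum (hm_restrict H M2) (hm_restrict H M2'))
        (hm_sum (hm_restrict H M1) (hm_restrict H M1')) (\<lambda>z. (F' (fst z), D' (snd z)))"
      using pair[OF cF(3) cD(3) F'(1) D'(1)] by (simp add: hm_bounded_linear_def)
    show "(F' (fst z), D' (snd z)) \<in> hm_carrier (hm_sum (hm_restrict H M1) (hm_restrict H M1'))"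
      if "z \<in> hm_carrier (hm_sum (hm_restrict H M2) (hm_restrict H M2'))" for z
      using hm_bounded_linear_mem[OF F'(1)] hm_bounded_linear_mem[OF D'(1)] that by auto
  qed (auto simp: F'(2,3) D'(2,3) intro!: pair cF cD bF bD)
  have fg: "hm_finitely_generated (hm_restrict ?HH (S N1 N1'))"
    unfolding restrict_S[OF cF(2) cD(2)]
    by (intro hm_finitely_generated_sum sm cF cD fgF fgD)
  have maps: "?T ` S M1 M1' \<subseteq> S M2 M2'" "?T ` S N1 N1' \<subseteq> S N2 N2'"
    unfolding carrier_S[OF cF(1) cD(1)] carrier_S[OF cF(2) cD(2)]
      carrier_S[OF cF(3) cD(3)] carrier_S[OF cF(4) cD(4)]
    using dF(3,4) dD(3,4) by auto
  show ?thesis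
    unfolding upper_semi_fredholm_def hm_diagonal_def mem_Collect_eq
    by (intro conjI exI[of _ "S M1 M1'"] exI[of _ "S N1 N1'"] exI[of _ "S M2 M2'"] exI[of _ "S N2 N2'"]
        upper_triangular_adjointable hm_adjointable_zero aF aD dec dF dD iso fg maps)
qed

text \<open>
  With \<open>P\<close> and \<open>Q\<close> the orthogonal projections onto \<open>N1'\<close> and \<open>N2\<close>, and \<open>L\<close> a left inverse
  of \<open>\<iota>\<close> that vanishes on the complement of \<open>N2\<close>, the operator is \<open>C = \<iota> P\<close>. The decompositions are
  \<open>M1 \<times> H\<close> and \<open>{(n, - L F n)}\<close> for the domain, \<open>{(a, b). Q a = \<iota> L a, b - D L a \<in> M2'}\<close>
  and \<open>(N2 \<inter> ker L) \<times> N2'\<close> for the codomain.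
\<close>

lemma upper_semi_fredholm_completion:
  assumes aF: "F \<in> hm_adjointable H H" and aD: "D \<in> hm_adjointable H H"
    and diagF: "hm_diagonal H F M1 N1 (hm_perp H N2) N2"
    and diagD: "hm_diagonal H D (hm_perp H N1') N1' M2' N2'"
    and iF: "hm_isomorphism (hm_restrict H M1) (hm_restrict H (hm_perp H N2)) F"
    and iD: "hm_isomorphism (hm_restrict H (hm_perp H N1')) (hm_restrict H M2') D"
    and fg: "hm_finitely_generated (hm_restrict H N1)"
    and ai: "\<iota> \<in> hm_adjointable (hm_restrict H N1') (hm_restrict H N2)"
    and ii: "hm_isomorphism (hm_restrict H N1') (hm_restrict H (\<iota> ` N1')) \<iota>"
  shows "\<exists>C \<in> hm_adjointable H H. upper_triangular F C D \<in> upper_semi_fredholm (hm_sum H H)"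
proof -
  let ?HH = "hm_sum H H"
  interpret HH: semi_hilbert_module ?HH
    by (rule semi_hilbert_module_sum) unfold_locales
  have sub: "M \<subseteq> hm_carrier H" "hm_submodule H M" if "hm_closed_submodule H M" for M
    using that by (simp_all add: hm_closed_submodule_def hm_submodule_def)
  have dF: "hm_decomposition H M1 N1" "hm_decomposition H (hm_perp H N2) N2"
      "F ` M1 \<subseteq> hm_perp H N2" "F ` N1 \<subseteq> N2"
    and dD: "hm_decomposition H (hm_perp H N1') N1'" "hm_decomposition H M2' N2'"
      "D ` hm_perp H N1' \<subseteq> M2'" "D ` N1' \<subseteq> N2'"
    using diagF diagD by (simp_all add: hm_diagonal_def)
  note cM1 = hm_decompositionD(1)[OF dF(1)] and cN1 = hm_decompositionD(2)[OF dF(1)]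
    and cO2 = hm_decompositionD(1)[OF dF(2)] and cN2 = hm_decompositionD(2)[OF dF(2)]
    and cO1' = hm_decompositionD(1)[OF dD(1)] and cN1' = hm_decompositionD(2)[OF dD(1)]
    and cM2' = hm_decompositionD(1)[OF dD(2)] and cN2' = hm_decompositionD(2)[OF dD(2)]
  note inH = subsetD[OF sub(1)]
  note sm = semi_hilbert_module_restrict[OF sub(2)]
  note weaken = hm_bounded_linear_restrict_codomain[THEN iffD1, THEN conjunct1]
  interpret N1': complete_hilbert_module "hm_restrict H N1'"
    by (rule complete_hilbert_module_restrict[OF cN1'])
  interpret N2: semi_hilbert_module "hm_restrict H N2" by (rule sm[OF cN2])
  note blF = hm_adjointable_bounded_linear[OF aF] and blD = hm_adjointable_bounded_linear[OF aD]
  note FH = hm_bounded_linear_mem[OF blF] and DH = hm_bounded_linear_mem[OF blD]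
  have bi: "hm_bounded_linear (hm_restrict H N1') (hm_restrict H N2) \<iota>"
    by (rule hm_adjointable_bounded_linear[OF ai])
  have iN2: "\<iota> x \<in> N2" if "x \<in> N1'" for x using hm_bounded_linear_mem[OF bi] that by simp
  obtain P where bP: "hm_bounded_linear H (hm_restrict H N1') P"
    and P: "\<And>x. x \<in> hm_carrier H \<Longrightarrow> x - P x \<in> hm_perp H N1'"
      "\<And>x. x \<in> N1' \<Longrightarrow> P x = x" "\<And>x. x \<in> hm_perp H N1' \<Longrightarrow> P x = 0"
      "\<And>x y. x \<in> hm_carrier H \<Longrightarrow> y \<in> N1' \<Longrightarrow> hm_inner H (P x) y = hm_inner H x y"
    using orthogonal_projection[OF dD(1)] by blast
  obtain Q where bQ: "hm_bounded_linear H (hm_restrict H N2) Q"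
    and Q: "\<And>x. x \<in> hm_carrier H \<Longrightarrow> x - Q x \<in> hm_perp H N2"
      "\<And>x. x \<in> N2 \<Longrightarrow> Q x = x" "\<And>x. x \<in> hm_perp H N2 \<Longrightarrow> Q x = 0"
      "\<And>x y. x \<in> hm_carrier H \<Longrightarrow> y \<in> N2 \<Longrightarrow> hm_inner H (Q x) y = hm_inner H x y"
    using orthogonal_projection[OF dF(2)] by blast
  have PN: "P x \<in> N1'" if "x \<in> hm_carrier H" for x using hm_bounded_linear_mem[OF bP that] by simp
  have QN: "Q x \<in> N2" if "x \<in> hm_carrier H" for x using hm_bounded_linear_mem[OF bQ that] by simp
  obtain J where bJ: "hm_bounded_linear (hm_restrict H (\<iota> ` N1')) (hm_restrict H N1') J"
    and J: "\<And>x. x \<in> N1' \<Longrightarrow> J (\<iota> x) = x"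
  proof (rule hm_isomorphism_inverse[OF ii N1'.semi_hilbert_module_axioms])
    fix S assume "hm_bounded_linear (hm_restrict H (\<iota> ` N1')) (hm_restrict H N1') S"
      "\<And>x. x \<in> hm_carrier (hm_restrict H N1') \<Longrightarrow> S (\<iota> x) = x"
    then show thesis by (intro that[of S]) simp_all
  qed
  obtain B where B: "0 \<le> B" "\<And>y. y \<in> \<iota> ` N1' \<Longrightarrow> hm_norm H (J y) \<le> B * hm_norm H y"
    using hm_bounded_linear_bound[OF bJ] by auto
  \<comment> \<open>A bound on the inverse of \<open>\<iota>\<close> is a lower bound for
    \<open>\<iota>\<close>; adding 1 avoids division by zero.\<close>
  have "1 / (B + 1) * hm_norm H x \<le> hm_norm H (\<iota> x)" if x: "x \<in> N1'" for x
  proof -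
    have "hm_norm H x \<le> B * hm_norm H (\<iota> x)" using B(2)[OF imageI[OF x]] J[OF x] by simp
    also have "\<dots> \<le> (B + 1) * hm_norm H (\<iota> x)" by (simp add: mult_right_mono)
    finally show ?thesis using B(1) by (simp add: field_simps)
  qed
  then obtain L0 where bL0: "hm_bounded_linear (hm_restrict H N2) (hm_restrict H N1') L0"
    and L0: "\<And>x. x \<in> N1' \<Longrightarrow> L0 (\<iota> x) = x"
    using N1'.adjointable_left_inverse[OF N2.semi_hilbert_module_axioms ai, of "1 / (B + 1)"] B(1)
    by auto
  define L where "L = (\<lambda>x. L0 (Q x))"
  define C where "C = (\<lambda>x. \<iota> (P x))"
  have bL': "hm_bounded_linear H (hm_restrict H N1') L"
    unfolding L_def by (rule hm_bounded_linear_compose[OF bQ bL0])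
  have bL: "hm_bounded_linear H H L" by (rule weaken[OF sub(1)[OF cN1'] bL'])
  have LN: "L x \<in> N1'" if "x \<in> hm_carrier H" for x using hm_bounded_linear_mem[OF bL' that] by simp
  note LH = inH[OF cN1' LN]
  have L_add: "L (x + y) = L x + L y" if "x \<in> hm_carrier H" "y \<in> hm_carrier H" for x y
    by (rule hm_bounded_linear_add[OF bL that])
  have L_diff: "L (x - y) = L x - L y" if "x \<in> hm_carrier H" "y \<in> hm_carrier H" for x y
    by (rule hm_bounded_linear_minus_arg[OF bL that])
  have bQH: "hm_bounded_linear H H Q" by (rule weaken[OF sub(1)[OF cN2] bQ])
  have Q_add: "Q (x + y) = Q x + Q y" if "x \<in> hm_carrier H" "y \<in> hm_carrier H" for x y
    by (rule hm_bounded_linear_add[OF bQH that])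
  have Q_diff: "Q (x - y) = Q x - Q y" if "x \<in> hm_carrier H" "y \<in> hm_carrier H" for x y
    by (rule hm_bounded_linear_minus_arg[OF bQH that])
  have L_i: "L (\<iota> x) = x" if "x \<in> N1'" for x
    using L0[OF that] Q(2)[OF iN2[OF that]] by (simp add: L_def)
  have L_perp: "L x = 0" if "x \<in> hm_perp H N2" for x
    using Q(3)[OF that] N2.hm_bounded_linear_zero[OF bL0] by (simp add: L_def)
  have L_Q: "L (Q x) = L x" if "x \<in> hm_carrier H" for x
    using Q(2)[OF QN[OF that]] by (simp add: L_def)
  have biL: "hm_bounded_linear H H (\<lambda>x. \<iota> (L x))"
    by (rule weaken[OF sub(1)[OF cN2] hm_bounded_linear_compose[OF bL' bi]])
  have bC: "hm_bounded_linear H H C"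
    unfolding C_def by (rule weaken[OF sub(1)[OF cN2] hm_bounded_linear_compose[OF bP bi]])
  have aC: "C \<in> hm_adjointable H H"
  proof -
    obtain S where S: "\<And>y. y \<in> N2 \<Longrightarrow> S y \<in> N1'"
      "\<And>x y. x \<in> N1' \<Longrightarrow> y \<in> N2 \<Longrightarrow> hm_inner H (\<iota> x) y = hm_inner H x (S y)"
      using ai unfolding hm_adjointable_def by auto
    have "hm_inner H (C x) y = hm_inner H x (S (Q y))"
      if x: "x \<in> hm_carrier H" and y: "y \<in> hm_carrier H" for x y
    proof -
      note i = iN2[OF PN[OF x]] and q = QN[OF y]
      have "hm_inner H (C x) y = hm_inner H (C x) (Q y)"
        using arg_cong[OF Q(4)[OF y i], of star] star_inner[OF y inH[OF cN2 i]]
          star_inner[OF inH[OF cN2 q] inH[OF cN2 i]] by (simp add: C_def)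
      also have "\<dots> = hm_inner H x (S (Q y))"
        using S(2)[OF PN[OF x] q] P(4)[OF x S(1)[OF q]] by (simp add: C_def)
      finally show ?thesis .
    qed
    moreover have "S (Q y) \<in> hm_carrier H" if "y \<in> hm_carrier H" for y
      using inH[OF cN1' S(1)[OF QN[OF that]]] .
    ultimately have "\<exists>S. S ` hm_carrier H \<subseteq> hm_carrier H \<and>
        (\<forall>x\<in>hm_carrier H. \<forall>y\<in>hm_carrier H. hm_inner H (C x) y = hm_inner H x (S y))"
      by (intro exI[of _ "\<lambda>y. S (Q y)"]) auto
    then show ?thesis using bC unfolding hm_adjointable_def hm_bounded_linear_def by blast
  qed
  obtain F' where bF': "hm_bounded_linear (hm_restrict H (hm_perp H N2)) (hm_restrict H M1) F'"
    and F': "\<And>x. x \<in> M1 \<Longrightarrow> F' (F x) = x" "\<And>y. y \<in> hm_perp H N2 \<Longrightarrow> F (F' y) = y"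
    using hm_isomorphism_inverse[OF iF sm[OF cM1]] by auto
  obtain D' where bD': "hm_bounded_linear (hm_restrict H M2') (hm_restrict H (hm_perp H N1')) D'"
    and D': "\<And>x. x \<in> hm_perp H N1' \<Longrightarrow> D' (D x) = x" "\<And>y. y \<in> M2' \<Longrightarrow> D (D' y) = y"
    using hm_isomorphism_inverse[OF iD sm[OF cO1']] by auto
  have F'M: "F' y \<in> M1" if "y \<in> hm_perp H N2" for y using hm_bounded_linear_mem[OF bF'] that by simp
  have D'O: "D' y \<in> hm_perp H N1'" if "y \<in> M2'" for y using hm_bounded_linear_mem[OF bD'] that by simp
  let ?T = "upper_triangular F C D"
  have aT: "?T \<in> hm_adjointable ?HH ?HH" by (rule upper_triangular_adjointable[OF aF aC aD])
  note blT = hm_adjointable_bounded_linear[OF aT]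
  define A1 where "A1 = {z \<in> hm_carrier ?HH. fst z \<in> M1}"
  \<comment> \<open>The image of \<open>(n, - L (F n))\<close> has first coordinate
    \<open>F n - \<iota> (L (F n))\<close>, which \<open>L\<close> annihilates; this dictates the
    second coordinate.\<close>
  define B1 where "B1 = {z \<in> hm_carrier ?HH. fst z \<in> N1} \<inter>
    {z \<in> hm_carrier ?HH. snd z + L (F (fst z)) = 0}"
  \<comment> \<open>For \<open>a = F m + C y\<close> and \<open>b = D y\<close> one finds
    \<open>L a = P y\<close> and \<open>Q a = \<iota> (P y)\<close>, while
    \<open>b - D (L a)\<close> is \<open>D\<close> applied to \<open>y - P y\<close>. The two
    conditions record exactly these constraints.\<close>
  define A2 where "A2 = {z \<in> hm_carrier ?HH. Q (fst z) - \<iota> (L (fst z)) = 0} \<inter>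
    {z \<in> hm_carrier ?HH. snd z - D (L (fst z)) \<in> M2'}"
  define B2 where "B2 = {z \<in> hm_carrier ?HH. fst z \<in> N2} \<inter>
    ({z \<in> hm_carrier ?HH. L (fst z) = 0} \<inter> {z \<in> hm_carrier ?HH. snd z \<in> N2'})"
  note fst_bl = hm_bounded_linear_compose_fst[OF hm_bounded_linear_id]
  note snd_bl = hm_bounded_linear_compose_snd[OF hm_bounded_linear_id]
  note ker = hm_closed_submodule_kernel[OF HH.semi_hilbert_module_axioms]
  note pre = HH.hm_closed_submodule_preimage
  have bLF: "hm_bounded_linear H H (\<lambda>x. L (F x))" by (rule hm_bounded_linear_compose[OF blF bL])
  have bDL: "hm_bounded_linear H H (\<lambda>x. D (L x))" by (rule hm_bounded_linear_compose[OF bL blD])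
  have bA2: "hm_bounded_linear ?HH H (\<lambda>z. snd z - D (L (fst z)))"
    by (rule hm_bounded_linear_diff[OF snd_bl hm_bounded_linear_compose_fst[OF bDL]])
  have cA1: "hm_closed_submodule ?HH A1" unfolding A1_def by (rule pre[OF cM1 fst_bl])
  have cB1: "hm_closed_submodule ?HH B1" unfolding B1_def
    by (intro hm_closed_submodule_Int pre[OF cN1 fst_bl] ker hm_bounded_linear_plus snd_bl
        hm_bounded_linear_compose_fst[OF bLF])
  have cA2: "hm_closed_submodule ?HH A2" unfolding A2_def
    by (intro hm_closed_submodule_Int pre[OF cM2' bA2] ker hm_bounded_linear_diff
        hm_bounded_linear_compose_fst[OF bQH] hm_bounded_linear_compose_fst[OF biL])
  have cB2: "hm_closed_submodule ?HH B2" unfolding B2_def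
    by (intro hm_closed_submodule_Int pre[OF cN2 fst_bl] pre[OF cN2' snd_bl] ker
        hm_bounded_linear_compose_fst[OF bL])
  have A1I: "z \<in> A1" if "fst z \<in> M1" "snd z \<in> hm_carrier H" for z
    using that inH[OF cM1 that(1)] by (auto simp: A1_def mem_Times_iff)
  have B1I: "z \<in> B1" if "fst z \<in> N1" "snd z = - L (F (fst z))" for z
    using that inH[OF cN1 that(1)] minus_mem[OF LH[OF FH[OF inH[OF cN1 that(1)]]]]
    by (auto simp: B1_def mem_Times_iff)
  have A2I: "z \<in> A2" if "fst z \<in> hm_carrier H" "snd z \<in> hm_carrier H" "Q (fst z) = \<iota> (L (fst z))"
    "snd z - D (L (fst z)) \<in> M2'" for z
    using that by (auto simp: A2_def mem_Times_iff)
  have B2I: "z \<in> B2" if "fst z \<in> N2" "L (fst z) = 0" "snd z \<in> N2'" for z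
    using that inH[OF cN2 that(1)] inH[OF cN2' that(3)] by (auto simp: B2_def mem_Times_iff)
  have A1D: "fst z \<in> M1" "fst z \<in> hm_carrier H" "snd z \<in> hm_carrier H" if "z \<in> A1" for z
    using that by (auto simp: A1_def)
  have B1D: "fst z \<in> N1" "fst z \<in> hm_carrier H" "snd z = - L (F (fst z))" if "z \<in> B1" for z
    using that by (auto simp: B1_def eq_neg_iff_add_eq_0)
  have A2D: "fst z \<in> hm_carrier H" "snd z \<in> hm_carrier H" "Q (fst z) = \<iota> (L (fst z))"
    "snd z - D (L (fst z)) \<in> M2'" if "z \<in> A2" for z
    using that by (auto simp: A2_def)
  have B2D: "fst z \<in> N2" "L (fst z) = 0" "snd z \<in> N2'" if "z \<in> B2" for z
    using that by (auto simp: B2_def)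
  have F0: "F 0 = 0" and D0: "D 0 = 0" and L_0: "L 0 = 0"
    using hm_bounded_linear_zero[OF blF] hm_bounded_linear_zero[OF blD] hm_bounded_linear_zero[OF bL]
    by simp_all
  have i0: "\<iota> 0 = 0" using N1'.hm_bounded_linear_zero[OF bi] .
  have dec1: "hm_decomposition ?HH A1 B1"
  proof (rule hm_decompositionI[OF cA1 cB1 _ _ HH.add_mem])
    show "z = 0" if A: "z \<in> A1" and B: "z \<in> B1" for z
    proof -
      have "fst z \<in> M1 \<inter> N1" using A1D(1)[OF A] B1D(1)[OF B] by (rule IntI)
      then have "fst z = 0" unfolding hm_decompositionD(3)[OF dF(1)] by simp
      then show ?thesis using B1D(3)[OF B] F0 L_0 by (simp add: prod_eq_iff)
    qed
    show "\<exists>m\<in>A1. \<exists>n\<in>B1. z = m + n" if z: "z \<in> hm_carrier ?HH" for z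
    proof -
      have zz: "fst z \<in> hm_carrier H" "snd z \<in> hm_carrier H" using z by auto
      obtain m n where mn: "m \<in> M1" "n \<in> N1" "fst z = m + n"
        using hm_decompositionD(4)[OF dF(1) zz(1)] by blast
      note LFn = LH[OF FH[OF inH[OF cN1 mn(2)]]]
      show ?thesis
      proof (rule bexI[of _ "(m, snd z + L (F n))"], rule bexI[of _ "(n, - L (F n))"])
        show "z = (m, snd z + L (F n)) + (n, - L (F n))" using mn(3) by (simp add: prod_eq_iff)
        show "(n, - L (F n)) \<in> B1" using mn(2) by (intro B1I) simp_all
        show "(m, snd z + L (F n)) \<in> A1" using mn(1) add_mem[OF zz(2) LFn] by (intro A1I) simp_all
      qed
    qed
  qed simp_all
  have dec2: "hm_decomposition ?HH A2 B2"
  proof (rule hm_decompositionI[OF cA2 cB2 _ _ HH.add_mem])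
    show "z = 0" if A: "z \<in> A2" and B: "z \<in> B2" for z
    proof -
      have f: "fst z = 0" using A2D(3)[OF A] B2D(2)[OF B] Q(2)[OF B2D(1)[OF B]] i0 by simp
      then have "snd z \<in> M2' \<inter> N2'" using A2D(4)[OF A] B2D(3)[OF B] D0 L_0 by simp
      then have "snd z = 0" unfolding hm_decompositionD(3)[OF dD(2)] by simp
      with f show ?thesis by (simp add: prod_eq_iff)
    qed
    show "\<exists>m\<in>A2. \<exists>n\<in>B2. z = m + n" if z: "z \<in> hm_carrier ?HH" for z
    proof -
      define a b where "a = fst z" and "b = snd z"
      have a: "a \<in> hm_carrier H" and b: "b \<in> hm_carrier H" using z by (auto simp: a_def b_def)
      \<comment> \<open>On \<open>N2\<close>, \<open>\<iota> L\<close> is the idempotent with range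
        \<open>\<iota> N1'\<close>; \<open>w\<close> is the part of \<open>Q a\<close> in the kernel
        of \<open>L\<close>.\<close>
      define w where "w = Q a - \<iota> (L a)"
      have iLa: "\<iota> (L a) \<in> N2" by (rule iN2[OF LN[OF a]])
      note iLaH = inH[OF cN2 iLa] and QaH = inH[OF cN2 QN[OF a]]
      have w: "w \<in> N2" using N2.diff_mem[of "Q a" "\<iota> (L a)"] QN[OF a] iLa by (simp add: w_def)
      note wH = inH[OF cN2 w]
      have Lw: "L w = 0"
        unfolding w_def L_diff[OF QaH iLaH] L_Q[OF a] L_i[OF LN[OF a]] by simp
      have La: "L (a - w) = L a" using L_diff[OF a wH] Lw by simp
      have Qa: "Q (a - w) = \<iota> (L (a - w))"
        unfolding La Q_diff[OF a wH] Q(2)[OF w] by (simp add: w_def)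
      obtain m s where ms: "m \<in> M2'" "s \<in> N2'" "b - D (L a) = m + s"
        using hm_decompositionD(4)[OF dD(2) diff_mem[OF b DH[OF LH[OF a]]]] by blast
      have bs: "b - s - D (L a) = m" using ms(3) by (simp add: algebra_simps)
      show ?thesis
      proof (rule bexI[of _ "(a - w, b - s)"], rule bexI[of _ "(w, s)"])
        show "z = (a - w, b - s) + (w, s)" by (simp add: prod_eq_iff a_def b_def)
        show "(w, s) \<in> B2" using w Lw ms(2) by (intro B2I) simp_all
        show "(a - w, b - s) \<in> A2"
          using diff_mem[OF a wH] diff_mem[OF b inH[OF cN2' ms(2)]] Qa La bs ms(1)
          by (intro A2I) simp_all
      qed
    qed
  qed simp_all
  \<comment> \<open>These identities recover from the first coordinate the part of \<open>y\<close>
    in \<open>N1'\<close> and the value \<open>F m\<close>, which the inverse needs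
    separately.\<close>
  have onA1: "L (F m + C y) = P y" "Q (F m + C y) = C y" "F m + C y - Q (F m + C y) = F m"
    if m: "m \<in> M1" and y: "y \<in> hm_carrier H" for m y
  proof -
    have Fm: "F m \<in> hm_perp H N2" using dF(3) m by blast
    have Cy: "C y \<in> N2" unfolding C_def by (rule iN2[OF PN[OF y]])
    note FmH = inH[OF cO2 Fm] and CyH = inH[OF cN2 Cy]
    show "L (F m + C y) = P y"
      unfolding L_add[OF FmH CyH] L_perp[OF Fm] by (simp add: C_def L_i[OF PN[OF y]])
    show QC: "Q (F m + C y) = C y"
      unfolding Q_add[OF FmH CyH] Q(3)[OF Fm] Q(2)[OF Cy] by simp
    show "F m + C y - Q (F m + C y) = F m" unfolding QC by simp
  qed
  have Ddiff: "D (x - y) = D x - D y" if "x \<in> hm_carrier H" "y \<in> hm_carrier H" for x y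
    by (rule hm_bounded_linear_minus_arg[OF blD that])
  have mapA: "?T ` A1 \<subseteq> A2"
  proof (rule image_subsetI)
    fix z assume z: "z \<in> A1"
    note m = A1D(1)[OF z] and mH = A1D(2)[OF z] and y = A1D(3)[OF z]
    have "D (snd z) - D (P (snd z)) = D (snd z - P (snd z))"
      using Ddiff[OF y inH[OF cN1' PN[OF y]]] by simp
    also have "\<dots> \<in> M2'" using dD(3) P(1)[OF y] by blast
    finally have "D (snd z) - D (P (snd z)) \<in> M2'" .
    then show "?T z \<in> A2"
      using onA1[OF m y] add_mem[OF FH[OF mH] hm_bounded_linear_mem[OF bC y]] DH[OF y]
      by (intro A2I) (simp_all add: C_def)
  qed
  have mapB: "?T ` B1 \<subseteq> B2"
  proof (rule image_subsetI)
    fix z assume z: "z \<in> B1"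
    note n = B1D(1)[OF z] and nH = B1D(2)[OF z]
    have Fn: "F (fst z) \<in> N2" using dF(4) n by blast
    have y: "snd z \<in> N1'" unfolding B1D(3)[OF z]
      using N1'.minus_mem[of "L (F (fst z))"] LN[OF FH[OF nH]] by simp
    have C: "C (snd z) = \<iota> (snd z)" using P(2)[OF y] by (simp add: C_def)
    note iy = iN2[OF y]
    have "L (F (fst z) + \<iota> (snd z)) = 0"
      unfolding L_add[OF FH[OF nH] inH[OF cN2 iy]] L_i[OF y] by (simp add: B1D(3)[OF z])
    moreover have "F (fst z) + \<iota> (snd z) \<in> N2"
      using N2.add_mem[of "F (fst z)" "\<iota> (snd z)"] Fn iy by simp
    moreover have "D (snd z) \<in> N2'" using dD(4) y by blast
    ultimately show "?T z \<in> B2" by (intro B2I) (simp_all add: C)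
  qed
  \<comment> \<open>\<open>F'\<close> recovers \<open>m\<close> from the part of \<open>a\<close>
    orthogonal to \<open>N2\<close>. The coordinate \<open>y\<close> is reassembled from its part
    \<open>L a\<close> in \<open>N1'\<close> and its orthogonal part, which \<open>D'\<close>
    recovers from \<open>b - D (L a)\<close>.\<close>
  let ?S = "\<lambda>z. (F' (fst z - Q (fst z)), D' (snd z - D (L (fst z))) + L (fst z))"
  have S_mem: "?S z \<in> A1" if z: "z \<in> A2" for z
    using F'M[OF Q(1)[OF A2D(1)[OF z]]] inH[OF cO1' D'O[OF A2D(4)[OF z]]] LH[OF A2D(1)[OF z]]
    by (intro A1I) (simp_all add: add_mem)
  have iso: "hm_isomorphism (hm_restrict ?HH A1) (hm_restrict ?HH A2) ?T"
  proof (rule hm_isomorphismI[where S = ?S])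
    show "hm_bounded_linear (hm_restrict ?HH A1) (hm_restrict ?HH A2) ?T"
      using hm_bounded_linear_restrict_domain[OF blT] mapA cA1 cA2
      by (simp add: hm_bounded_linear_restrict_codomain hm_closed_submodule_def hm_submodule_def)
    show "?S z \<in> hm_carrier (hm_restrict ?HH A1)" if "z \<in> hm_carrier (hm_restrict ?HH A2)" for z
      using S_mem that by simp
    show "?S (?T z) = z" if "z \<in> hm_carrier (hm_restrict ?HH A1)" for z
    proof -
      have z: "z \<in> A1" using that by simp
      note m = A1D(1)[OF z] and y = A1D(3)[OF z]
      have "D (snd z) - D (P (snd z)) = D (snd z - P (snd z))"
        using Ddiff[OF y inH[OF cN1' PN[OF y]]] by simp
      then have "D' (D (snd z) - D (P (snd z))) = snd z - P (snd z)" using D'(1)[OF P(1)[OF y]] by simp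
      then show ?thesis using onA1[OF m y] F'(1)[OF m] by (simp add: prod_eq_iff)
    qed
    show "?T (?S z) = z" if "z \<in> hm_carrier (hm_restrict ?HH A2)" for z
    proof -
      have z: "z \<in> A2" using that by simp
      define a b where "a = fst z" and "b = snd z"
      note d = A2D[OF z, folded a_def b_def]
      note u = D'O[OF d(4)] and La = LN[OF d(1)]
      note uH = inH[OF cO1' u] and LaH = LH[OF d(1)]
      have bPH: "hm_bounded_linear H H P" by (rule weaken[OF sub(1)[OF cN1'] bP])
      have "P (D' (b - D (L a)) + L a) = L a"
        unfolding hm_bounded_linear_add[OF bPH uH LaH] P(3)[OF u] P(2)[OF La] by simp
      then have "F (F' (a - Q a)) + C (D' (b - D (L a)) + L a) = a"
        unfolding C_def F'(2)[OF Q(1)[OF d(1)]] using d(3) by simp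
      moreover have "D (D' (b - D (L a)) + L a) = b"
        unfolding hm_bounded_linear_add[OF blD uH LaH] D'(2)[OF d(4)] by simp
      ultimately show ?thesis by (simp add: prod_eq_iff a_def b_def)
    qed
    have A2H: "A2 \<subseteq> hm_carrier ?HH" using cA2 by (simp add: hm_closed_submodule_def hm_submodule_def)
    \<comment> \<open>\<open>F'\<close> and \<open>D'\<close> are bounded only on the ranges they
      invert, so their arguments are first shown to stay in those submodules.\<close>
    have "hm_bounded_linear (hm_restrict ?HH A2) H (\<lambda>z. fst z - Q (fst z))"
      by (intro hm_bounded_linear_restrict_domain[OF _ A2H] hm_bounded_linear_diff fst_bl
          hm_bounded_linear_compose_fst[OF bQH])
    then have "hm_bounded_linear (hm_restrict ?HH A2) (hm_restrict H (hm_perp H N2)) (\<lambda>z. fst z - Q (fst z))"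
      unfolding hm_bounded_linear_restrict_codomain[OF sub(1)[OF cO2]]
      using Q(1)[OF A2D(1)] by auto
    from weaken[OF sub(1)[OF cM1] hm_bounded_linear_compose[OF this bF']]
    have 1: "hm_bounded_linear (hm_restrict ?HH A2) H (\<lambda>z. F' (fst z - Q (fst z)))" .
    have "hm_bounded_linear (hm_restrict ?HH A2) (hm_restrict H M2') (\<lambda>z. snd z - D (L (fst z)))"
      unfolding hm_bounded_linear_restrict_codomain[OF sub(1)[OF cM2']]
      using hm_bounded_linear_restrict_domain[OF bA2 A2H] A2D(4) by auto
    from weaken[OF sub(1)[OF cO1'] hm_bounded_linear_compose[OF this bD']]
    have 2: "hm_bounded_linear (hm_restrict ?HH A2) H (\<lambda>z. D' (snd z - D (L (fst z))))" .
    have "hm_bounded_linear (hm_restrict ?HH A2) ?HH ?S"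
      by (intro hm_bounded_linear_pair 1 hm_bounded_linear_plus 2
          hm_bounded_linear_restrict_domain[OF hm_bounded_linear_compose_fst[OF bL] A2H])
    then show "hm_bounded (hm_restrict ?HH A2) (hm_restrict ?HH A1) ?S"
      by (simp add: hm_bounded_linear_def hm_bounded_def)
  qed
  \<comment> \<open>\<open>B1\<close> is the graph of \<open>- L F\<close> over \<open>N1\<close>,
    hence a bounded linear image of a finitely generated module.\<close>
  have fgB: "hm_finitely_generated (hm_restrict ?HH B1)"
  proof (rule hm_finitely_generated_image[OF sm[OF cN1] _ fg])
    show "semi_hilbert_module (hm_restrict ?HH B1)"
      using cB1 by (intro HH.semi_hilbert_module_restrict) (simp add: hm_closed_submodule_def)
    have "hm_bounded_linear H H (\<lambda>x. 0)"
      using hm_adjointable_bounded_linear[OF hm_adjointable_zero] .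
    from hm_bounded_linear_diff[OF this bLF]
    have "hm_bounded_linear H H (\<lambda>x. - L (F x))" by simp
    then have "hm_bounded_linear (hm_restrict H N1) ?HH (\<lambda>x. (x, - L (F x)))"
      by (intro hm_bounded_linear_restrict_domain[OF _ sub(1)[OF cN1]] hm_bounded_linear_pair
          hm_bounded_linear_id)
    then show "hm_bounded_linear (hm_restrict H N1) (hm_restrict ?HH B1) (\<lambda>x. (x, - L (F x)))"
      using cB1 B1I by (auto simp: hm_bounded_linear_restrict_codomain hm_closed_submodule_def hm_submodule_def)
    show "hm_carrier (hm_restrict ?HH B1) \<subseteq> (\<lambda>x. (x, - L (F x))) ` hm_carrier (hm_restrict H N1)"
    proof
      fix z assume "z \<in> hm_carrier (hm_restrict ?HH B1)"
      then have z: "z \<in> B1" by simp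
      show "z \<in> (\<lambda>x. (x, - L (F x))) ` hm_carrier (hm_restrict H N1)"
        using B1D(1,3)[OF z] by (intro image_eqI[of _ _ "fst z"]) (simp_all add: prod_eq_iff)
    qed
  qed
  have "?T \<in> upper_semi_fredholm ?HH"
    unfolding upper_semi_fredholm_def hm_diagonal_def mem_Collect_eq
    by (intro conjI exI[of _ A1] exI[of _ B1] exI[of _ A2] exI[of _ B2] aT dec1 dec2 iso fgB mapA mapB)
  then show ?thesis using aC by blast
qed

end

theorem theorem3p18:
  fixes F D :: "(nat \<Rightarrow> 'a::unital_cstar_algebra) \<Rightarrow> (nat \<Rightarrow> 'a)"
  assumes "F \<in> upper_semi_fredholm hm_standard"
    and "D \<in> hm_adjointable hm_standard hm_standard"
    and "D \<in> upper_semi_fredholm hm_standard \<or>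
      (\<exists>M1 N1 N2 N1' M2' N2'.
        hm_diagonal hm_standard F M1 N1 (hm_perp hm_standard N2) N2 \<and>
        hm_diagonal hm_standard D (hm_perp hm_standard N1') N1' M2' N2' \<and>
        hm_isomorphism (hm_restrict hm_standard M1)
          (hm_restrict hm_standard (hm_perp hm_standard N2)) F \<and>
        hm_isomorphism (hm_restrict hm_standard (hm_perp hm_standard N1'))
          (hm_restrict hm_standard M2') D \<and>
        hm_finitely_generated (hm_restrict hm_standard N1) \<and>
        (\<exists>\<iota> \<in> hm_adjointable (hm_restrict hm_standard N1') (hm_restrict hm_standard N2).
          hm_isomorphism (hm_restrict hm_standard N1') (hm_restrict hm_standard (\<iota> ` N1')) \<iota>))"
  shows "\<exists>C \<in> hm_adjointable hm_standard hm_standard.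
    upper_triangular F C D \<in> upper_semi_fredholm (hm_sum hm_standard hm_standard)"
  using assms(3)
proof (elim disjE exE conjE bexE)
  interpret complete_hilbert_module "hm_standard :: ('a, nat \<Rightarrow> 'a) hilbert_module"
    by (rule complete_hilbert_module_standard)
  show ?thesis if "D \<in> upper_semi_fredholm hm_standard"
    using upper_semi_fredholm_sum[OF assms(1) that] standard.hm_adjointable_zero by blast
  have aF: "F \<in> hm_adjointable hm_standard hm_standard"
    using assms(1) by (simp add: upper_semi_fredholm_def)
  show ?thesis
    if "hm_diagonal hm_standard F M1 N1 (hm_perp hm_standard N2) N2"
      "hm_diagonal hm_standard D (hm_perp hm_standard N1') N1' M2' N2'"
      "hm_isomorphism (hm_restrict hm_standard M1) (hm_restrict hm_standard (hm_perp hm_standard N2)) F"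
      "hm_isomorphism (hm_restrict hm_standard (hm_perp hm_standard N1')) (hm_restrict hm_standard M2') D"
      "hm_finitely_generated (hm_restrict hm_standard N1)"
      "\<iota> \<in> hm_adjointable (hm_restrict hm_standard N1') (hm_restrict hm_standard N2)"
      "hm_isomorphism (hm_restrict hm_standard N1') (hm_restrict hm_standard (\<iota> ` N1')) \<iota>"
    for M1 N1 N2 N1' M2' N2' \<iota>
    by (rule upper_semi_fredholm_completion[OF aF assms(2) that])
qed

end
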